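(* Assume that all the functions $f_1,\dots,f_M$ are constant. Let $1\le k\le M$. Let $\widehat p_{M+1}$ be the splitting estimator with $M$ intermediate thresholds and replication numbers $R_1,\dots,R_M$, and let $\widehat p_M^{(-k)}$ be the splitting estimator obtained by running the algorithm with the $k$-th threshold deleted (thus with $M-1$ intermediate thresholds) and with the reallocated replication numbers determined by $\lambda_{k-1},\dots,\lambda_{M-1}$. Put $\Lambda_q=\prod_{j=k-1}^q\lambda_j$ for $k-1\le q\le M-1$. Then $$\mathrm{Var}(\widehat p_{M+1})=\mathrm{Var}\bigl(\widehat p_M^{(-k)}\bigr)+\frac1{r_{k-1}}\left(1-\frac1{\Lambda_{k-1}R_k}\right)\gamma_{k-1}\bigl(\Gamma_k(f_k)\bigr)+\sum_{j=k}^M\frac1{r_j}\left(1-\frac1{\Lambda_{j-1}}\right)\gamma_j\bigl(\Gamma_{j+1}(f_{j+1})\bigr).$$ Similarly, the mean cost $C_{M+1}$ of the algorithm with $M$ thresholds and the mean cost $C_M^{(-k)}$ of the algorithm with the $k$-th threshold deleted satisfy $$C_{M+1}=C_M^{(-k)}+r_{k-1}\Bigl[\gamma_{k-1}(c_{k-1})-R_k\Lambda_{k-1}\gamma_{k-1}(\tilde c_{k-1})\Bigr]+r_k\gamma_k(c_k)+\sum_{j=k+1}^Mr_j\gamma_j(c_j)\bigl(1-\Lambda_{j-1}\bigr),$$ where $\tilde c_{k-1}$ is the unitary cost of a particle going from the $(k-1)$-th threshold to the next one in the algorithm with $M-1$ levels.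
   Context: **Model.** Fix integers $M\ge1$ and $s\ge 1$. There are nested events (thresholds) $B=B_{M+1}\subset B_M\subset\dots\subset B_1$. For $1\le k\le M$ the frontier $\partial B_k$ is partitioned into $s$ disjoint subsets $\partial B_k^{(1)},\dots,\partial B_k^{(s)}$. A particle starts at a fixed point $O$ and evolves so that a threshold can be hit only if all previous ones have been hit. Let $\tau_k$ be the first hitting time of $\partial B_k$ (with $\tau_0<\infty$ surely), and let $X_k=i$ if the particle is in $\partial B_k^{(i)}$ at time $\tau_k$. The embedded process $(X_k)$, killed at level $k$ if $\tau_k=\infty$, is a Markov chain. Functions on $\partial B_k$ (the set $\mathcal F_k$) are functions on $\{1,\dots,s\}$. Measures on $\partial B_k$ are measures on $\{1,\dots,s\}$, and $\mu(f)=\sum_i\mu(i)f(i)$. **Quantities.** The target is $p=\mathbb P(\tau_{M+1}<\infty)$. For $1\le k\le M$: $\gamma_k(i)=\mathbb P(X_k=i,\ \tau_k<\infty)$, so $\gamma_k(\mathbf 1)=\mathbb P(\tau_k<\infty)$, where $\mathbf 1$ is the unit function; and $f_k(i)=\mathbb P(\tau_{M+1}<\infty\mid X_k=i,\ \tau_k<\infty)$. For $2\le k\le M$: $P_k(i,j)=\mathbb P(X_k=j,\ \tau_k<\infty\mid X_{k-1}=i,\ \tau_{k-1}<\infty)$, acting on functions by $P_k(f)(i)=\sum_jP_k(i,j)f(j)$, and $g_{k-1}(i)=P_k(\mathbf 1)(i)$. It is assumed that $\gamma_k(\mathbf 1)\ne0$ for all $k$ (including $\gamma_{M+1}(\mathbf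 1)=p\ne0$). **Conventions at the ends.** $\mathcal F_0$ and $\mathcal F_{M+1}$ consist of constants. $f_0=p$, $g_0=\gamma_1(\mathbf 1)$, $\gamma_0(f)=f$, $P_1(f)=\gamma_1(f)$; $f_{M+1}=1$, $g_M=f_M$, $\gamma_{M+1}(f)=pf$, $P_{M+1}(f)=f\times f_M$. **Operators $\Gamma$.** For $1\le k\le M+1$ and $f\in\mathcal F_k$, $\Gamma_k(f)=P_k(f^2)-(P_k(f))^2\in\mathcal F_{k-1}$. **Algorithm.** Let $N\ge1$ and $R_1,\dots,R_M\ge1$ be integers, $r_0=N$, $r_n=R_nr_{n-1}$. First, $N$ independent particles start from $O$. Each independently lands in $\partial B_1^{(j)}$ with probability $\gamma_1(j)$ and dies with probability $1-\gamma_1(\mathbf 1)$; $Z_{1j}$ is the number landing in $\partial B_1^{(j)}$. For $2\le n\le M$, given $\mathbf Z_{n-1}=(Z_{(n-1)1},\dots,Z_{(n-1)s})$, each particle is duplicated $R_{n-1}$ times, and each of the $R_{n-1}Z_{(n-1)i}$ copies located in $\partial B_{n-1}^{(i)}$ independently reaches $\partial B_n^{(j)}$ with probability $P_n(i,j)$ and dies with probability $1-g_{n-1}(i)$; $Z_{nj}$ is the number of copies reaching $\partial B_n^{(j)}$. Finally, each particle in $\partial B_M$ is duplicated $R_M$ times, and each of the $R_MZ_{Mi}$ copies located in $\partial B_M^{(i)}$ independently reaches $B_{M+1}$ with probability $f_M(i)$; $Z_{M+1}$ is the number of copies reaching $B_{M+1}$. The estimator is $\widehat p_{M+1}=Z_{M+1}/r_M$.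 **Cost.** Let $c$ be a positive decreasing function. Each initial particle has unitary cost $c_0=c(\gamma_1(\mathbf 1))$, and each copy started from $\partial B_k^{(i)}$ has unitary cost $c_k(i)=c(g_k(i))$, $1\le k\le M$. The mean cost $C_{M+1}$ is the expectation of the sum of the unitary costs of all particles generated, $Nc_0+\sum_{n=1}^M\sum_{i}R_nZ_{ni}c_n(i)$. **Deleting the $k$-th threshold.** The algorithm is run with the $M-1$ intermediate thresholds $\partial B_1,\dots,\partial B_{k-1},\partial B_{k+1},\dots,\partial B_M$ and the same target $B_{M+1}$. The transition from $\partial B_{k-1}$ to the next level $\partial B_{k+1}$ is governed by $P_kP_{k+1}$. Given real numbers $\lambda_{k-1},\dots,\lambda_{M-1}>0$ (such that the resulting numbers are admissible, i.e. positive integers), the replication numbers $R'_1,\dots,R'_{M-1}$ of this algorithm, numbered in the order of the remaining thresholds, are: $R'_j=R_j$ for $1\le j\le k-2$; $R'_{k-1}=\lambda_{k-1}R_{k-1}R_k$; $R'_j=\lambda_jR_{j+1}$ for $k\le j\le M-1$. The initial number of particles is unchanged ($N$), except that for $k=1$ one reads $R_0=N$ and the rule for $R'_{k-1}$ gives the new initial number of particles $\lambda_0NR_1$. The estimator $\widehat p_M^{(-k)}$ is the number of particles reaching $B_{M+1}$ divided by the product of the initial number of particles and all replication numbers of this algorithm. In its mean cost $C_M^{(-k)}$, particles started from $\partial B_{k-1}^{(i)}$ have unitary cost $\tilde c_{k-1}(i)$ (a given function $\tilde c_{k-1}\in\mathcal F_{k-1}$), while particles started from $\partial B_j$, $j\ne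 k-1,k$, keep the unitary cost $c_j$. *)

theory Defs
  imports "HOL-Probability.Probability"
begin

record ('w, 'x) splitting =
  probsp :: "'w measure"
  nthr   :: nat                          \<comment> \<open>number \<open>M\<close> of intermediate thresholds\<close>
  ncell  :: nat                          \<comment> \<open>number \<open>s\<close> of cells of an intermediate frontier\<close>
  origin :: 'x
  thr    :: "nat \<Rightarrow> 'x set"              \<comment> \<open>\<open>B\<^sub>1, \<dots>, B\<^sub>M\<^sub>+\<^sub>1\<close>\<close>
  part   :: "nat \<Rightarrow> nat \<Rightarrow> 'x set"       \<comment> \<open>\<open>part k i\<close>: the \<open>i\<close>-th cell of the frontier of \<open>B\<^sub>k\<close>\<close>
  traj   :: "real \<Rightarrow> 'w \<Rightarrow> 'x"           \<comment> \<open>position at time \<open>t \<ge> 0\<close>\<close>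

text \<open>
  Levels run from \<open>0\<close> (the starting point) to \<open>L + 1\<close> (the target), \<open>L\<close> being the number of
  intermediate thresholds. The levels \<open>0\<close> and \<open>L + 1\<close> have the single cell \<open>1\<close>, so that
  functions on these levels are constants.
\<close>

definition cells :: "nat \<Rightarrow> nat \<Rightarrow> nat \<Rightarrow> nat set" where
  "cells L s k = (if k = 0 \<or> k = L + 1 then {1} else {1..s})"

abbreviation scells :: "('w, 'x) splitting \<Rightarrow> nat \<Rightarrow> nat set" where
  "scells S \<equiv> cells (nthr S) (ncell S)"

definition boundary :: "('w, 'x::topological_space) splitting \<Rightarrow> nat \<Rightarrow> 'x set" where
  "boundary S k = (if k = 0 then {origin S} else frontier (thr S k))"

definition cell :: "('w, 'x::topological_space) splitting \<Rightarrow> nat \<Rightarrow> nat \<Rightarrow> 'x set" where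
  "cell S k i = (if k = 0 \<or> k = nthr S + 1 then boundary S k else part S k i)"

definition hit_time :: "('w, 'x::topological_space) splitting \<Rightarrow> nat \<Rightarrow> 'w \<Rightarrow> ereal" where
  "hit_time S k \<omega> = Inf (ereal ` {t. 0 \<le> t \<and> traj S t \<omega> \<in> boundary S k})"

definition hit_cell :: "('w, 'x::topological_space) splitting \<Rightarrow> nat \<Rightarrow> 'w \<Rightarrow> nat" where
  "hit_cell S k \<omega> =
     (THE i. i \<in> scells S k \<and> traj S (real_of_ereal (hit_time S k \<omega>)) \<omega> \<in> cell S k i)"

definition embedded :: "('w, 'x::topological_space) splitting \<Rightarrow> nat \<Rightarrow> 'w \<Rightarrow> nat option" where
  "embedded S k \<omega> = (if hit_time S k \<omega> < \<infinity> then Some (hit_cell S k \<omega>) else None)"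

text \<open>
  The assumption \<open>attained\<close> says that the particle is on the frontier at its hitting time, which
  is what gives \<open>hit_cell\<close> a meaning; it is automatic for continuous trajectories. In \<open>markov\<close>,
  \<open>h\<close> ranges over all histories of the killed chain, \<open>None\<close> being the killed state.
\<close>

locale splitting_model = prob_space "probsp S"
  for S :: "('w, 'x::topological_space) splitting" +
  assumes nthr_ge_1: "nthr S \<ge> 1"
    and ncell_ge_1: "ncell S \<ge> 1"
    and nested: "\<And>k. 1 \<le> k \<Longrightarrow> k \<le> nthr S \<Longrightarrow> thr S (k + 1) \<subseteq> thr S k"
    and part_cover: "\<And>k. 1 \<le> k \<Longrightarrow> k \<le> nthr S \<Longrightarrow>
           (\<Union>i\<in>{1..ncell S}. part S k i) = frontier (thr S k)"
    and part_disjoint: "\<And>k. 1 \<le> k \<Longrightarrow> k \<le> nthr S \<Longrightarrow> disjoint_family_on (part S k) {1..ncell S}"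
    and start: "\<And>\<omega>. \<omega> \<in> space (probsp S) \<Longrightarrow> traj S 0 \<omega> = origin S"
    and attained: "\<And>k \<omega>. 1 \<le> k \<Longrightarrow> k \<le> nthr S + 1 \<Longrightarrow> \<omega> \<in> space (probsp S) \<Longrightarrow>
           hit_time S k \<omega> < \<infinity> \<Longrightarrow>
           traj S (real_of_ereal (hit_time S k \<omega>)) \<omega> \<in> boundary S k"
    and ordered: "\<And>k \<omega>. 1 \<le> k \<Longrightarrow> k \<le> nthr S \<Longrightarrow> \<omega> \<in> space (probsp S) \<Longrightarrow>
           hit_time S k \<omega> \<le> hit_time S (k + 1) \<omega>"
    and embedded_measurable: "\<And>k i. k \<le> nthr S + 1 \<Longrightarrow>
           {\<omega> \<in> space (probsp S). embedded S k \<omega> = Some i} \<in> sets (probsp S)"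
    and markov: "\<And>k (h :: nat \<Rightarrow> nat option) x. k \<le> nthr S \<Longrightarrow>
           \<P>(\<omega> in probsp S. \<forall>m\<le>k. embedded S m \<omega> = h m) \<noteq> 0 \<Longrightarrow>
           \<P>(\<omega> in probsp S. embedded S (k + 1) \<omega> = x \<bar> \<forall>m\<le>k. embedded S m \<omega> = h m) =
           \<P>(\<omega> in probsp S. embedded S (k + 1) \<omega> = x \<bar> embedded S k \<omega> = h k)"

text \<open>
  Since \<open>cond_prob\<close> is \<open>0\<close> when the conditioning event is null, \<open>kern S k i j\<close> and
  \<open>target_prob S k i\<close> have the value \<open>0\<close> at cells \<open>i\<close> that are reached with probability \<open>0\<close>.
\<close>

definition gam :: "('w, 'x::topological_space) splitting \<Rightarrow> nat \<Rightarrow> nat \<Rightarrow> real" where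
  "gam S k i = \<P>(\<omega> in probsp S. hit_time S k \<omega> < \<infinity> \<and> hit_cell S k \<omega> = i)"

definition gam_int :: "('w, 'x::topological_space) splitting \<Rightarrow> nat \<Rightarrow> (nat \<Rightarrow> real) \<Rightarrow> real" where
  "gam_int S k f = (\<Sum>i\<in>scells S k. gam S k i * f i)"

definition kern :: "('w, 'x::topological_space) splitting \<Rightarrow> nat \<Rightarrow> nat \<Rightarrow> nat \<Rightarrow> real" where
  "kern S k i j =
     \<P>(\<omega> in probsp S. hit_time S k \<omega> < \<infinity> \<and> hit_cell S k \<omega> = j \<bar>
                       hit_time S (k - 1) \<omega> < \<infinity> \<and> hit_cell S (k - 1) \<omega> = i)"

definition kern_op ::
  "('w, 'x::topological_space) splitting \<Rightarrow> nat \<Rightarrow> (nat \<Rightarrow> real) \<Rightarrow> nat \<Rightarrow> real" where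
  "kern_op S k f i = (\<Sum>j\<in>scells S k. kern S k i j * f j)"

definition next_prob :: "('w, 'x::topological_space) splitting \<Rightarrow> nat \<Rightarrow> nat \<Rightarrow> real" where
  "next_prob S k = kern_op S (k + 1) (\<lambda>_. 1)"

definition target_prob :: "('w, 'x::topological_space) splitting \<Rightarrow> nat \<Rightarrow> nat \<Rightarrow> real" where
  "target_prob S k i =
     \<P>(\<omega> in probsp S. hit_time S (nthr S + 1) \<omega> < \<infinity> \<bar>
                       hit_time S k \<omega> < \<infinity> \<and> hit_cell S k \<omega> = i)"

definition Gamma_op ::
  "('w, 'x::topological_space) splitting \<Rightarrow> nat \<Rightarrow> (nat \<Rightarrow> real) \<Rightarrow> nat \<Rightarrow> real" where
  "Gamma_op S k f i = kern_op S k (\<lambda>j. (f j)\<^sup>2) i - (kern_op S k f i)\<^sup>2"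

text \<open>
  A function on level \<open>k\<close> given by conditioning on the current cell is only determined on the cells
  charged by \<open>gam S k\<close>, and constancy is meant there.
\<close>

definition constant_on_level ::
  "('w, 'x::topological_space) splitting \<Rightarrow> nat \<Rightarrow> (nat \<Rightarrow> real) \<Rightarrow> bool" where
  "constant_on_level S k f \<longleftrightarrow> (\<exists>a. \<forall>i\<in>scells S k. gam S k i \<noteq> 0 \<longrightarrow> f i = a)"

text \<open>
  The algorithm with \<open>L\<close> intermediate thresholds, \<open>s\<close> cells per threshold, transition kernels
  \<open>K 1, \<dots>, K (L + 1)\<close> (\<open>K n\<close> leads from level \<open>n - 1\<close> to level \<open>n\<close>) and replication numbers
  \<open>R 0, \<dots>, R L\<close>. The initial number of particles is \<open>R 0\<close>: the run starts from a single
  particle at level \<open>0\<close>, which is replicated \<open>R 0\<close> times. A run is recorded as \<open>Z\<close>,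
  where \<open>Z n i\<close> is the number of particles reaching cell \<open>i\<close> of level \<open>n\<close>.
\<close>

definition move_pmf :: "nat set \<Rightarrow> (nat \<Rightarrow> real) \<Rightarrow> nat option pmf" where
  "move_pmf C q = embed_pmf (\<lambda>x. case x of
      None \<Rightarrow> 1 - (\<Sum>j\<in>C. q j)
    | Some j \<Rightarrow> if j \<in> C then q j else 0)"

definition copies :: "nat set \<Rightarrow> nat \<Rightarrow> (nat \<Rightarrow> nat) \<Rightarrow> (nat \<times> nat) set" where
  "copies C r z = (SIGMA i:C. {..<r * z i})"

definition step_pmf ::
  "nat set \<Rightarrow> nat set \<Rightarrow> nat \<Rightarrow> (nat \<Rightarrow> nat \<Rightarrow> real) \<Rightarrow> (nat \<Rightarrow> nat) \<Rightarrow> (nat \<Rightarrow> nat) pmf" where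
  "step_pmf C C' r K z =
     map_pmf (\<lambda>y j. card {a \<in> copies C r z. y a = Some j})
       (Pi_pmf (copies C r z) None (\<lambda>(i, m). move_pmf C' (K i)))"

primrec run_pmf ::
  "nat \<Rightarrow> nat \<Rightarrow> (nat \<Rightarrow> nat \<Rightarrow> nat \<Rightarrow> real) \<Rightarrow> (nat \<Rightarrow> nat) \<Rightarrow> nat \<Rightarrow> (nat \<Rightarrow> nat \<Rightarrow> nat) pmf" where
  "run_pmf L s K R 0 = return_pmf (\<lambda>n i. if n = 0 \<and> i = 1 then 1 else 0)"
| "run_pmf L s K R (Suc n) =
     bind_pmf (run_pmf L s K R n) (\<lambda>Z.
       map_pmf (\<lambda>z. Z(Suc n := z))
         (step_pmf (cells L s n) (cells L s (Suc n)) (R n) (K (Suc n)) (Z n)))"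

definition algorithm_pmf ::
  "nat \<Rightarrow> nat \<Rightarrow> (nat \<Rightarrow> nat \<Rightarrow> nat \<Rightarrow> real) \<Rightarrow> (nat \<Rightarrow> nat) \<Rightarrow> (nat \<Rightarrow> nat \<Rightarrow> nat) pmf" where
  "algorithm_pmf L s K R = run_pmf L s K R (L + 1)"

definition total_rep :: "(nat \<Rightarrow> nat) \<Rightarrow> nat \<Rightarrow> nat" where
  "total_rep R n = (\<Prod>j\<le>n. R j)"

definition estimator :: "nat \<Rightarrow> (nat \<Rightarrow> nat) \<Rightarrow> (nat \<Rightarrow> nat \<Rightarrow> nat) \<Rightarrow> real" where
  "estimator L R Z = real (Z (L + 1) 1) / real (total_rep R L)"

definition estimator_variance ::
  "nat \<Rightarrow> nat \<Rightarrow> (nat \<Rightarrow> nat \<Rightarrow> nat \<Rightarrow> real) \<Rightarrow> (nat \<Rightarrow> nat) \<Rightarrow> real" where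
  "estimator_variance L s K R = measure_pmf.variance (algorithm_pmf L s K R) (estimator L R)"

definition mean_cost ::
  "nat \<Rightarrow> nat \<Rightarrow> (nat \<Rightarrow> nat \<Rightarrow> nat \<Rightarrow> real) \<Rightarrow> (nat \<Rightarrow> nat) \<Rightarrow> (nat \<Rightarrow> nat \<Rightarrow> real) \<Rightarrow> real" where
  "mean_cost L s K R u = measure_pmf.expectation (algorithm_pmf L s K R)
     (\<lambda>Z. \<Sum>n\<le>L. \<Sum>i\<in>cells L s n. real (R n * Z n i) * u n i)"

definition unit_cost ::
  "(real \<Rightarrow> real) \<Rightarrow> ('w, 'x::topological_space) splitting \<Rightarrow> nat \<Rightarrow> nat \<Rightarrow> real" where
  "unit_cost c S n i = c (next_prob S n i)"

text \<open>
  After deletion of threshold \<open>k\<close>, level \<open>n < k\<close> is the old level \<open>n\<close>, and level \<open>n \<ge> k\<close> is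
  the old level \<open>n + 1\<close>; the transition to level \<open>k\<close> is the composition of \<open>kern S k\<close> and
  \<open>kern S (k + 1)\<close>.
\<close>

definition del_kern ::
  "('w, 'x::topological_space) splitting \<Rightarrow> nat \<Rightarrow> nat \<Rightarrow> nat \<Rightarrow> nat \<Rightarrow> real" where
  "del_kern S k n i j =
     (if n < k then kern S n i j
      else if n = k then (\<Sum>l\<in>scells S k. kern S k i l * kern S (k + 1) l j)
      else kern S (n + 1) i j)"

definition del_cost ::
  "(real \<Rightarrow> real) \<Rightarrow> (nat \<Rightarrow> real) \<Rightarrow> ('w, 'x::topological_space) splitting \<Rightarrow>
   nat \<Rightarrow> nat \<Rightarrow> nat \<Rightarrow> real" where
  "del_cost c ct S k n i =
     (if n < k - 1 then unit_cost c S n i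
      else if n = k - 1 then ct i
      else unit_cost c S (n + 1) i)"

definition del_rep :: "(nat \<Rightarrow> real) \<Rightarrow> (nat \<Rightarrow> nat) \<Rightarrow> nat \<Rightarrow> nat \<Rightarrow> real" where
  "del_rep lam R k j =
     (if j < k - 1 then real (R j)
      else if j = k - 1 then lam (k - 1) * real (R (k - 1)) * real (R k)
      else lam j * real (R (j + 1)))"

lemma pmf_move_pmf:
  assumes "finite C" "\<And>j. j \<in> C \<Longrightarrow> 0 \<le> q j" "(\<Sum>j\<in>C. q j) \<le> 1"
  shows "pmf (move_pmf C q) x =
    (case x of None \<Rightarrow> 1 - (\<Sum>j\<in>C. q j) | Some j \<Rightarrow> if j \<in> C then q j else 0)" (is "_ = ?f x")
proof -
  have nn: "0 \<le> ?f y" for y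
    using assms by (auto split: option.split)
  have "(\<integral>\<^sup>+y. ennreal (?f y) \<partial>count_space UNIV)
      = (\<Sum>y\<in>insert None (Some ` C). ennreal (?f y))"
    by (rule nn_integral_count_space') (use assms in \<open>auto split: option.splits\<close>)
  also have "\<dots> = ennreal (\<Sum>y\<in>insert None (Some ` C). ?f y)"
    using nn by (simp only: sum_ennreal)
  also have "(\<Sum>y\<in>insert None (Some ` C). ?f y) = 1"
    using assms(1) by (subst sum.insert) (auto simp: sum.reindex)
  finally show ?thesis
    unfolding move_pmf_def using nn by (subst pmf_embed_pmf) auto
qed

context splitting_model
begin

lemma hit_time_0: "\<omega> \<in> space (probsp S) \<Longrightarrow> hit_time S 0 \<omega> = 0"
proof -
  assume "\<omega> \<in> space (probsp S)"
  then have "0 \<in> {t. 0 \<le> t \<and> traj S t \<omega> \<in> boundary S 0}"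
    using start by (simp add: boundary_def)
  then have "ereal 0 \<in> ereal ` {t. 0 \<le> t \<and> traj S t \<omega> \<in> boundary S 0}"
    by (rule imageI)
  then have "hit_time S 0 \<omega> \<le> ereal 0"
    unfolding hit_time_def by (rule Inf_lower)
  moreover have "0 \<le> hit_time S 0 \<omega>"
    unfolding hit_time_def by (rule Inf_greatest) auto
  ultimately show ?thesis
    by (simp add: zero_ereal_def)
qed

lemma hit_cell_0: "\<omega> \<in> space (probsp S) \<Longrightarrow> hit_cell S 0 \<omega> = 1"
  unfolding hit_cell_def
  by (rule the_equality) (simp_all add: start hit_time_0 cells_def cell_def boundary_def)

lemma hit_cell_last:
  "\<omega> \<in> space (probsp S) \<Longrightarrow> hit_time S (nthr S + 1) \<omega> < \<infinity> \<Longrightarrow> hit_cell S (nthr S + 1) \<omega> = 1"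
  unfolding hit_cell_def using attained[of "nthr S + 1" \<omega>]
  by (intro the_equality) (simp_all add: cells_def cell_def)

lemma hit_cell_mem:
  assumes "1 \<le> k" "k \<le> nthr S" "\<omega> \<in> space (probsp S)" "hit_time S k \<omega> < \<infinity>"
  shows "hit_cell S k \<omega> \<in> {1..ncell S}"
    and "traj S (real_of_ereal (hit_time S k \<omega>)) \<omega> \<in> part S k (hit_cell S k \<omega>)"
proof -
  let ?x = "traj S (real_of_ereal (hit_time S k \<omega>)) \<omega>"
  have "?x \<in> frontier (thr S k)"
    using attained[of k \<omega>] assms by (simp add: boundary_def)
  then have "?x \<in> (\<Union>i\<in>{1..ncell S}. part S k i)"
    by (simp only: part_cover[OF assms(1,2)])
  then obtain i where i: "i \<in> {1..ncell S}" "?x \<in> part S k i" by (rule UN_E)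
  have uniq: "j = i" if j: "j \<in> {1..ncell S}" "?x \<in> part S k j" for j
  proof (rule ccontr)
    assume "j \<noteq> i"
    with part_disjoint[OF assms(1,2)] i(1) j(1) have "part S k j \<inter> part S k i = {}"
      unfolding disjoint_family_on_def by blast
    with i(2) j(2) show False by blast
  qed
  have cell: "scells S k = {1..ncell S}" "cell S k l = part S k l" for l
    using assms(1,2) by (simp_all add: cells_def cell_def)
  have "hit_cell S k \<omega> = i"
    unfolding hit_cell_def cell by (rule the_equality) (use i uniq in blast)+
  with i show "hit_cell S k \<omega> \<in> {1..ncell S}" "?x \<in> part S k (hit_cell S k \<omega>)" by simp_all
qed

lemma gam_0: "gam S 0 1 = 1"
proof -
  have "{\<omega> \<in> space (probsp S). hit_time S 0 \<omega> < \<infinity> \<and> hit_cell S 0 \<omega> = 1} = space (probsp S)"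
    by (auto simp: hit_time_0 hit_cell_0)
  then show ?thesis by (simp add: gam_def prob_space)
qed

lemma gam_last: "gam S (nthr S + 1) 1 = \<P>(\<omega> in probsp S. hit_time S (nthr S + 1) \<omega> < \<infinity>)"
  unfolding gam_def using hit_cell_last by (intro arg_cong[where f = prob]) auto

lemma kern_first: "kern S 1 1 j = gam S 1 j"
proof -
  have "{\<omega> \<in> space (probsp S). (hit_time S 1 \<omega> < \<infinity> \<and> hit_cell S 1 \<omega> = j) \<and>
           hit_time S 0 \<omega> < \<infinity> \<and> hit_cell S 0 \<omega> = 1} =
        {\<omega> \<in> space (probsp S). hit_time S 1 \<omega> < \<infinity> \<and> hit_cell S 1 \<omega> = j}"
    by (auto simp: hit_time_0 hit_cell_0)
  then show ?thesis
    using gam_0 by (simp add: kern_def cond_prob_def gam_def)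
qed

lemma kern_last: "kern S (nthr S + 1) i 1 = target_prob S (nthr S) i"
proof -
  have "{\<omega> \<in> space (probsp S). (hit_time S (nthr S + 1) \<omega> < \<infinity> \<and> hit_cell S (nthr S + 1) \<omega> = 1) \<and>
           hit_time S (nthr S) \<omega> < \<infinity> \<and> hit_cell S (nthr S) \<omega> = i} =
        {\<omega> \<in> space (probsp S). hit_time S (nthr S + 1) \<omega> < \<infinity> \<and>
           hit_time S (nthr S) \<omega> < \<infinity> \<and> hit_cell S (nthr S) \<omega> = i}"
    using hit_cell_last by auto
  then show ?thesis
    by (simp add: kern_def cond_prob_def target_prob_def)
qed

lemma next_prob_first: "next_prob S 0 1 = gam_int S 1 (\<lambda>_. 1)"
  using kern_first by (simp add: next_prob_def kern_op_def gam_int_def)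

lemma next_prob_last: "next_prob S (nthr S) i = target_prob S (nthr S) i"
  using kern_last by (simp add: next_prob_def kern_op_def cells_def)

lemma target_prob_first:
  "target_prob S 0 1 = \<P>(\<omega> in probsp S. hit_time S (nthr S + 1) \<omega> < \<infinity>)"
proof -
  have "{\<omega> \<in> space (probsp S). hit_time S (nthr S + 1) \<omega> < \<infinity> \<and>
           hit_time S 0 \<omega> < \<infinity> \<and> hit_cell S 0 \<omega> = 1} =
        {\<omega> \<in> space (probsp S). hit_time S (nthr S + 1) \<omega> < \<infinity>}"
    by (auto simp: hit_time_0 hit_cell_0)
  then show ?thesis
    using gam_0 by (simp add: target_prob_def cond_prob_def gam_def)
qed

lemma target_prob_last:
  assumes "gam S (nthr S + 1) 1 \<noteq> 0"
  shows "target_prob S (nthr S + 1) 1 = 1"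
proof -
  have "{\<omega> \<in> space (probsp S). hit_time S (nthr S + 1) \<omega> < \<infinity> \<and>
           hit_time S (nthr S + 1) \<omega> < \<infinity> \<and> hit_cell S (nthr S + 1) \<omega> = 1} =
        {\<omega> \<in> space (probsp S). hit_time S (nthr S + 1) \<omega> < \<infinity> \<and> hit_cell S (nthr S + 1) \<omega> = 1}"
    by auto
  then show ?thesis
    using assms by (simp add: target_prob_def cond_prob_def gam_def)
qed

end

end

theory Submission
  imports Defs
begin

text \<open>
  For a splitting scheme with levels \<open>0, \<dots>, L + 1\<close>, let \<open>f\<^sub>n(i)\<close> be the probability of reaching the target
  from cell \<open>i\<close> of level \<open>n\<close>. The Markov property gives \<open>f\<^sub>n = P\<^bsub>n+1\<^esub>(f\<^bsub>n+1\<^esub>)\<close>, so that the sum of \<open>f\<^sub>n\<close> over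
  the particles at level \<open>n\<close>, divided by \<open>r\<^bsub>n-1\<^esub>\<close>, is a martingale that starts at \<open>p\<close> and ends at the
  estimator. Its increments are orthogonal. Given level \<open>n\<close>, the copies move independently, which makes
  the mean square of the increment equal to \<open>\<gamma>\<^sub>n(\<Gamma>\<^bsub>n+1\<^esub>(f\<^bsub>n+1\<^esub>)) / r\<^sub>n\<close>. Hence the variance is the sum
  \<open>v\<^sub>0 / r\<^sub>0 + \<dots> + v\<^sub>L / r\<^sub>L\<close> with \<open>v\<^sub>n = \<gamma>\<^sub>n(\<Gamma>\<^bsub>n+1\<^esub>(f\<^bsub>n+1\<^esub>))\<close> (\<open>estimator_variance_eq\<close>). In the same way,
  \<open>r\<^sub>n \<gamma>\<^sub>n(i)\<close> is the mean number of copies started from cell \<open>i\<close> of level \<open>n\<close>, which yields the mean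
  cost (\<open>mean_cost_eq\<close>).
  
  Deleting threshold \<open>k\<close> replaces the kernels \<open>P\<^sub>k\<close> and \<open>P\<^bsub>k+1\<^esub>\<close> by their composition and leaves the
  functions \<open>f\<^sub>n\<close> at the other levels unchanged. By the law of total variance (\<open>Gamma_op_compose\<close>) the
  composed step has the variance term \<open>v\<^bsub>k-1\<^esub> + v\<^sub>k\<close>. The reallocated replication numbers multiply up to
  \<open>\<Lambda>\<^bsub>k-1\<^esub> r\<^sub>k\<close> at this step and to \<open>\<Lambda>\<^bsub>j-1\<^esub> r\<^sub>j\<close> at the step starting from the old level \<open>j > k\<close>
  (\<open>total_rep_del_rep\<close>). Both identities then follow by comparing the sums term by term.
\<close>

section \<open>Moments of one generation\<close>

lemma expectation_bind_pmf_finite: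
  fixes h :: "'b \<Rightarrow> real"
  assumes "finite (set_pmf p)" "\<And>x. x \<in> set_pmf p \<Longrightarrow> finite (set_pmf (f x))"
  shows "measure_pmf.expectation (bind_pmf p f) h =
           measure_pmf.expectation p (\<lambda>x. measure_pmf.expectation (f x) h)"
  using assms by (simp add: pmf_expectation_bind[of "set_pmf p"] integral_measure_pmf[of "set_pmf p"])

lemma finite_set_Pi_pmf:
  assumes "finite A" "\<And>a. a \<in> A \<Longrightarrow> finite (set_pmf (p a))"
  shows "finite (set_pmf (Pi_pmf A d p))"
  unfolding set_Pi_pmf[OF assms(1)] using assms by (intro finite_PiE_dflt) auto

text \<open>
  Adding one coordinate at a time shows that mean and variance of a sum over independent
  coordinates are additive: the cross term of the square factors, because the new coordinate is
  drawn independently of the others. The finite supports make every integrability condition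
  automatic.
\<close>

lemma moments_sum_Pi_pmf:
  fixes G :: "'a \<Rightarrow> 'b \<Rightarrow> real"
  assumes "finite A" "\<And>a. a \<in> A \<Longrightarrow> finite (set_pmf (p a))"
  defines "\<mu> \<equiv> \<lambda>a. measure_pmf.expectation (p a) (G a)"
  shows "measure_pmf.expectation (Pi_pmf A d p) (\<lambda>y. \<Sum>a\<in>A. G a (y a)) = (\<Sum>a\<in>A. \<mu> a)"
    and "measure_pmf.expectation (Pi_pmf A d p) (\<lambda>y. (\<Sum>a\<in>A. G a (y a))\<^sup>2) =
           (\<Sum>a\<in>A. \<mu> a)\<^sup>2 + (\<Sum>a\<in>A. measure_pmf.expectation (p a) (\<lambda>x. (G a x)\<^sup>2) - (\<mu> a)\<^sup>2)"
proof -
  let ?E = "measure_pmf.expectation"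
  have "?E (Pi_pmf A d p) (\<lambda>y. \<Sum>a\<in>A. G a (y a)) = (\<Sum>a\<in>A. \<mu> a) \<and>
        ?E (Pi_pmf A d p) (\<lambda>y. (\<Sum>a\<in>A. G a (y a))\<^sup>2) =
           (\<Sum>a\<in>A. \<mu> a)\<^sup>2 + (\<Sum>a\<in>A. ?E (p a) (\<lambda>x. (G a x)\<^sup>2) - (\<mu> a)\<^sup>2)"
    using assms(1,2)
  proof (induction A rule: finite_induct)
    case empty
    then show ?case by simp
  next
    case (insert a A)
    define Q where "Q = Pi_pmf A d p"
    define T where "T y = (\<Sum>b\<in>A. G b (y b))" for y
    have fin: "finite (set_pmf (p a))" "finite (set_pmf Q)"
      using insert unfolding Q_def by (auto intro: finite_set_Pi_pmf)
    have int: "integrable (measure_pmf (p a)) f" "integrable (measure_pmf Q) h"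
      for f :: "'b \<Rightarrow> real" and h :: "('a \<Rightarrow> 'b) \<Rightarrow> real"
      using fin by (auto intro: integrable_measure_pmf_finite)
    have IH: "?E Q T = (\<Sum>a\<in>A. \<mu> a)"
      "?E Q (\<lambda>y. (T y)\<^sup>2) = (\<Sum>a\<in>A. \<mu> a)\<^sup>2 + (\<Sum>a\<in>A. ?E (p a) (\<lambda>x. (G a x)\<^sup>2) - (\<mu> a)\<^sup>2)"
      unfolding Q_def T_def using insert by auto
    have sum_upd: "(\<Sum>b\<in>insert a A. G b ((y(a := x)) b)) = G a x + T y" for x y
    proof -
      have "(\<Sum>b\<in>A. G b ((y(a := x)) b)) = T y"
        unfolding T_def using insert.hyps by (intro sum.cong) auto
      then show ?thesis using insert.hyps by simp
    qed
    have unfold: "?E (Pi_pmf (insert a A) d p) (\<lambda>y. h (\<Sum>b\<in>insert a A. G b (y b))) =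
        ?E (p a) (\<lambda>x. ?E Q (\<lambda>y. h (G a x + T y)))" for h :: "real \<Rightarrow> real"
      unfolding Pi_pmf_insert'[OF insert.hyps] Q_def[symmetric] using fin
      by (simp add: expectation_bind_pmf_finite sum_upd del: sum.insert fun_upd_apply)
    have "?E (p a) (\<lambda>x. ?E Q (\<lambda>y. G a x + T y)) = \<mu> a + (\<Sum>a\<in>A. \<mu> a)"
      using int IH by (simp add: \<mu>_def)
    moreover have "?E (p a) (\<lambda>x. ?E Q (\<lambda>y. (G a x + T y)\<^sup>2)) =
        ?E (p a) (\<lambda>x. (G a x)\<^sup>2) + ?E Q (\<lambda>y. (T y)\<^sup>2) + 2 * \<mu> a * ?E Q T"
      using int by (simp add: power2_sum \<mu>_def mult.assoc)
    ultimately show ?case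
      unfolding unfold[of "\<lambda>x. x"] unfold[of "\<lambda>x. x\<^sup>2"] using insert.hyps
      by (simp add: IH power2_sum)
  qed
  then show "?E (Pi_pmf A d p) (\<lambda>y. \<Sum>a\<in>A. G a (y a)) = (\<Sum>a\<in>A. \<mu> a)"
    "?E (Pi_pmf A d p) (\<lambda>y. (\<Sum>a\<in>A. G a (y a))\<^sup>2) =
           (\<Sum>a\<in>A. \<mu> a)\<^sup>2 + (\<Sum>a\<in>A. ?E (p a) (\<lambda>x. (G a x)\<^sup>2) - (\<mu> a)\<^sup>2)"
    by auto
qed

lemma finite_set_move_pmf:
  assumes "finite C" "\<And>j. j \<in> C \<Longrightarrow> 0 \<le> q j" "(\<Sum>j\<in>C. q j) \<le> 1"
  shows "finite (set_pmf (move_pmf C q))"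
proof (rule finite_subset)
  show "set_pmf (move_pmf C q) \<subseteq> insert None (Some ` C)"
  proof
    fix x assume "x \<in> set_pmf (move_pmf C q)"
    then show "x \<in> insert None (Some ` C)"
      using pmf_move_pmf[of C q x] assms by (cases x) (auto simp: set_pmf_iff split: if_splits)
  qed
qed (use assms in auto)

text \<open>
  Functions of the landing cell are extended by \<open>0\<close> to the killed state, so that killing
  contributes nothing and only the sub-probability \<open>q\<close> remains visible.
\<close>

lemma expectation_move_pmf:
  fixes h :: "nat option \<Rightarrow> real"
  assumes "finite C" "\<And>j. j \<in> C \<Longrightarrow> 0 \<le> q j" "(\<Sum>j\<in>C. q j) \<le> 1" and "h None = 0"
  shows "measure_pmf.expectation (move_pmf C q) h = (\<Sum>j\<in>C. q j * h (Some j))"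
proof -
  have pmf: "pmf (move_pmf C q) x =
      (case x of None \<Rightarrow> 1 - (\<Sum>j\<in>C. q j) | Some j \<Rightarrow> if j \<in> C then q j else 0)" for x
    by (rule pmf_move_pmf) (use assms in auto)
  have "measure_pmf.expectation (move_pmf C q) h =
      (\<Sum>x\<in>insert None (Some ` C). pmf (move_pmf C q) x *\<^sub>R h x)"
    using assms(1) by (intro integral_measure_pmf) (auto simp: set_pmf_eq pmf split: option.splits if_splits)
  also have "\<dots> = (\<Sum>j\<in>C. q j * h (Some j))"
    using assms(1,4) by (subst sum.insert) (auto simp: sum.reindex pmf)
  finally show ?thesis .
qed

lemma finite_cells [simp]: "finite (cells L s n)"
  by (simp add: cells_def)

lemma finite_copies: "finite C \<Longrightarrow> finite (copies C r z)"
  by (simp add: copies_def)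

lemma sum_copies:
  "finite C \<Longrightarrow> (\<Sum>a\<in>copies C r z. f (fst a)) = (\<Sum>i\<in>C. real (r * z i) * f i)"
  for f :: "nat \<Rightarrow> real"
  unfolding copies_def by (subst sum.Sigma[symmetric, of C "\<lambda>i. {..<r * z i}" "\<lambda>i m. f i", unfolded split_def]) auto

text \<open>
  A linear statistic of the occupation numbers is a sum over the individual copies. This turns the
  counts produced by a generation, which are dependent, into a sum of independent terms.
\<close>

lemma sum_card_landing:
  fixes g :: "nat \<Rightarrow> real"
  assumes "finite C" "finite A"
  shows "(\<Sum>j\<in>C. real (card {a \<in> A. y a = Some j}) * g j) =
         (\<Sum>a\<in>A. case y a of None \<Rightarrow> 0 | Some j \<Rightarrow> if j \<in> C then g j else 0)"
proof -
  have "(\<Sum>j\<in>C. real (card {a \<in> A. y a = Some j}) * g j) =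
      (\<Sum>j\<in>C. \<Sum>a\<in>A. if y a = Some j then g j else 0)"
    using assms by (intro sum.cong) (auto simp: sum.If_cases Int_def)
  also have "\<dots> = (\<Sum>a\<in>A. \<Sum>j\<in>C. if y a = Some j then g j else 0)"
    by (rule sum.swap)
  also have "\<dots> = (\<Sum>a\<in>A. case y a of None \<Rightarrow> 0 | Some j \<Rightarrow> if j \<in> C then g j else 0)"
    using assms(1) by (intro sum.cong refl) (auto split: option.splits)
  finally show ?thesis .
qed

lemma finite_set_step_pmf:
  assumes "finite C" "finite C'"
    and "\<And>i j. i \<in> C \<Longrightarrow> j \<in> C' \<Longrightarrow> 0 \<le> K i j" "\<And>i. i \<in> C \<Longrightarrow> (\<Sum>j\<in>C'. K i j) \<le> 1"
  shows "finite (set_pmf (step_pmf C C' r K z))"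
  unfolding step_pmf_def using assms
  by (auto intro!: finite_imageI finite_set_Pi_pmf finite_copies finite_set_move_pmf simp: copies_def)

text \<open>
  One generation: given \<open>z\<close>, the copies move independently, so the conditional mean of a linear
  statistic is the statistic of \<open>P g\<close>, and the conditional variance collects one term
  \<open>P(g\<^sup>2) - (P g)\<^sup>2\<close> per copy. This is where the operators \<open>\<Gamma>\<close> come from.
\<close>

lemma moments_step_pmf:
  fixes g :: "nat \<Rightarrow> real"
  assumes fin: "finite C" "finite C'"
    and K: "\<And>i j. i \<in> C \<Longrightarrow> j \<in> C' \<Longrightarrow> 0 \<le> K i j" "\<And>i. i \<in> C \<Longrightarrow> (\<Sum>j\<in>C'. K i j) \<le> 1"
  defines "P \<equiv> \<lambda>f i. \<Sum>j\<in>C'. K i j * f j"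
  shows "measure_pmf.expectation (step_pmf C C' r K z) (\<lambda>z'. \<Sum>j\<in>C'. real (z' j) * g j) =
           (\<Sum>i\<in>C. real (r * z i) * P g i)"
    and "measure_pmf.expectation (step_pmf C C' r K z) (\<lambda>z'. (\<Sum>j\<in>C'. real (z' j) * g j)\<^sup>2) =
           (\<Sum>i\<in>C. real (r * z i) * P g i)\<^sup>2
           + (\<Sum>i\<in>C. real (r * z i) * (P (\<lambda>j. (g j)\<^sup>2) i - (P g i)\<^sup>2))"
proof -
  let ?E = "measure_pmf.expectation"
  let ?A = "copies C r z" and ?p = "\<lambda>(i, m). move_pmf C' (K i)"
  define h where "h x = (case x of None \<Rightarrow> 0 | Some j \<Rightarrow> if j \<in> C' then g j else 0)" for x
  have finA: "finite ?A" using fin(1) by (rule finite_copies)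
  have land: "(\<Sum>j\<in>C'. real (card {a \<in> ?A. y a = Some j}) * g j) = (\<Sum>a\<in>?A. h (y a))" for y
    unfolding h_def using fin(2) finA by (rule sum_card_landing)
  have sup: "finite (set_pmf (?p a))" if "a \<in> ?A" for a
    using that fin K by (auto simp: copies_def intro: finite_set_move_pmf)
  have m1: "?E (?p a) h = P g (fst a)" if "a \<in> ?A" for a
    using that fin K by (auto simp: copies_def expectation_move_pmf h_def P_def intro!: sum.cong)
  have m2: "?E (?p a) (\<lambda>x. (h x)\<^sup>2) = P (\<lambda>j. (g j)\<^sup>2) (fst a)" if "a \<in> ?A" for a
    using that fin K by (auto simp: copies_def expectation_move_pmf h_def P_def intro!: sum.cong)
  have mom: "?E (Pi_pmf ?A None ?p) (\<lambda>y. \<Sum>a\<in>?A. h (y a)) = (\<Sum>a\<in>?A. ?E (?p a) h)"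
    "?E (Pi_pmf ?A None ?p) (\<lambda>y. (\<Sum>a\<in>?A. h (y a))\<^sup>2) =
       (\<Sum>a\<in>?A. ?E (?p a) h)\<^sup>2 + (\<Sum>a\<in>?A. ?E (?p a) (\<lambda>x. (h x)\<^sup>2) - (?E (?p a) h)\<^sup>2)"
    using moments_sum_Pi_pmf[OF finA, of ?p None "\<lambda>_. h"] sup by blast+
  have s1: "(\<Sum>a\<in>?A. ?E (?p a) h) = (\<Sum>i\<in>C. real (r * z i) * P g i)"
    by (subst sum_copies[OF fin(1), symmetric]) (rule sum.cong[OF refl m1])
  have s2: "(\<Sum>a\<in>?A. ?E (?p a) (\<lambda>x. (h x)\<^sup>2) - (?E (?p a) h)\<^sup>2) =
      (\<Sum>i\<in>C. real (r * z i) * (P (\<lambda>j. (g j)\<^sup>2) i - (P g i)\<^sup>2))"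
    by (subst sum_copies[OF fin(1), symmetric]) (intro sum.cong refl arg_cong2[where f = "(-)"] m2 arg_cong[where f = "\<lambda>x. x\<^sup>2"] m1)
  show "?E (step_pmf C C' r K z) (\<lambda>z'. \<Sum>j\<in>C'. real (z' j) * g j) =
           (\<Sum>i\<in>C. real (r * z i) * P g i)"
    unfolding step_pmf_def integral_map_pmf land mom s1 ..
  show "?E (step_pmf C C' r K z) (\<lambda>z'. (\<Sum>j\<in>C'. real (z' j) * g j)\<^sup>2) =
           (\<Sum>i\<in>C. real (r * z i) * P g i)\<^sup>2
           + (\<Sum>i\<in>C. real (r * z i) * (P (\<lambda>j. (g j)\<^sup>2) i - (P g i)\<^sup>2))"
    unfolding step_pmf_def integral_map_pmf land mom s1 s2 ..
qed

section \<open>Variance and cost of a splitting scheme\<close>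

text \<open>
  Only the substochastic kernels and the replication numbers matter for the law of a run. Abstracting
  from the underlying process lets one computation serve for the algorithm with all thresholds and
  for the algorithm with one threshold deleted, whose kernels are not of the form \<open>kern\<close>.
\<close>

locale splitting_scheme =
  fixes L s :: nat and K :: "nat \<Rightarrow> nat \<Rightarrow> nat \<Rightarrow> real" and R :: "nat \<Rightarrow> nat"
  assumes K_nonneg: "\<And>n i j. n \<le> L \<Longrightarrow> i \<in> cells L s n \<Longrightarrow> j \<in> cells L s (Suc n) \<Longrightarrow> 0 \<le> K (Suc n) i j"
    and K_sub: "\<And>n i. n \<le> L \<Longrightarrow> i \<in> cells L s n \<Longrightarrow> (\<Sum>j\<in>cells L s (Suc n). K (Suc n) i j) \<le> 1"
    and R_pos: "\<And>n. n \<le> L \<Longrightarrow> R n \<ge> 1"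
begin

definition transfer :: "nat \<Rightarrow> (nat \<Rightarrow> real) \<Rightarrow> nat \<Rightarrow> real" where
  "transfer n g i = (\<Sum>j\<in>cells L s n. K n i j * g j)"

definition noise :: "nat \<Rightarrow> (nat \<Rightarrow> real) \<Rightarrow> nat \<Rightarrow> real" where
  "noise n g i = transfer n (\<lambda>j. (g j)\<^sup>2) i - (transfer n g i)\<^sup>2"

text \<open>
  This is the functional \<open>\<gamma>\<^sub>n(g)\<close>. It is defined by pulling \<open>g\<close> back through the kernels to
  the single cell of level \<open>0\<close>, so that no reaching probabilities have to be introduced.
\<close>

primrec gamma_val :: "nat \<Rightarrow> (nat \<Rightarrow> real) \<Rightarrow> real" where
  "gamma_val 0 g = g 1"
| "gamma_val (Suc n) g = gamma_val n (transfer (Suc n) g)"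

text \<open>
  The replications made before level \<open>n\<close> is reached, that is \<open>r\<^bsub>n-1\<^esub>\<close>, with the value \<open>1\<close> at
  \<open>n = 0\<close>: the particles counted at level \<open>n\<close> have not yet been replicated \<open>R n\<close> times.
\<close>

definition prior_rep :: "nat \<Rightarrow> real" where
  "prior_rep n = (\<Prod>j<n. real (R j))"

abbreviation tally :: "(nat \<Rightarrow> nat \<Rightarrow> nat) \<Rightarrow> nat \<Rightarrow> (nat \<Rightarrow> real) \<Rightarrow> real" where
  "tally Z n g \<equiv> \<Sum>i\<in>cells L s n. real (Z n i) * g i"

abbreviation run :: "nat \<Rightarrow> (nat \<Rightarrow> nat \<Rightarrow> nat) pmf" where
  "run \<equiv> run_pmf L s K R"

lemma prior_rep_pos: "n \<le> L + 1 \<Longrightarrow> prior_rep n > 0"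
  unfolding prior_rep_def by (intro prod_pos) (use R_pos in \<open>force simp: Suc_le_eq\<close>)

lemma prior_rep_Suc: "prior_rep (Suc n) = real (total_rep R n)"
  by (simp add: prior_rep_def total_rep_def lessThan_Suc_atMost)

lemma finite_step: "n \<le> L \<Longrightarrow>
    finite (set_pmf (step_pmf (cells L s n) (cells L s (Suc n)) (R n) (K (Suc n)) z))"
  by (intro finite_set_step_pmf) (simp_all add: K_nonneg K_sub)

lemma finite_run: "n \<le> L + 1 \<Longrightarrow> finite (set_pmf (run n))"
  by (induction n) (auto intro!: finite_step)

lemma integrable_run: "n \<le> L + 1 \<Longrightarrow> integrable (measure_pmf (run n)) f"
  for f :: "(nat \<Rightarrow> nat \<Rightarrow> nat) \<Rightarrow> real"
  by (intro integrable_measure_pmf_finite finite_run)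

lemma expectation_run_Suc:
  fixes h :: "(nat \<Rightarrow> nat \<Rightarrow> nat) \<Rightarrow> real"
  assumes "n \<le> L"
  shows "measure_pmf.expectation (run (Suc n)) h =
    measure_pmf.expectation (run n) (\<lambda>Z. measure_pmf.expectation
      (step_pmf (cells L s n) (cells L s (Suc n)) (R n) (K (Suc n)) (Z n)) (\<lambda>z. h (Z(Suc n := z))))"
  using assms finite_run[of n] finite_step
  by (simp add: expectation_bind_pmf_finite)

text \<open>
  Later generations do not overwrite the counts already recorded, so a cost term at level \<open>n\<close> can be
  evaluated on the run stopped at level \<open>n\<close>.
\<close>

lemma expectation_run_earlier:
  fixes h :: "(nat \<Rightarrow> nat) \<Rightarrow> real"
  assumes "n \<le> m" "m \<le> L + 1"
  shows "measure_pmf.expectation (run m) (\<lambda>Z. h (Z n)) = measure_pmf.expectation (run n) (\<lambda>Z. h (Z n))"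
  using assms
proof (induction m rule: dec_induct)
  case (step m)
  then have "m \<le> L" by simp
  with step show ?case by (simp add: expectation_run_Suc del: run_pmf.simps)
qed simp

lemma expectation_tally:
  "n \<le> L + 1 \<Longrightarrow> measure_pmf.expectation (run n) (\<lambda>Z. tally Z n g) = prior_rep n * gamma_val n g"
proof (induction n arbitrary: g)
  case 0
  then show ?case by (simp add: prior_rep_def cells_def)
next
  case (Suc n)
  then have n: "n \<le> L" "n \<le> L + 1" by auto
  have "measure_pmf.expectation (run (Suc n)) (\<lambda>Z. tally Z (Suc n) g) =
      measure_pmf.expectation (run n) (\<lambda>Z. \<Sum>i\<in>cells L s n. real (R n * Z n i) * transfer (Suc n) g i)"
    unfolding expectation_run_Suc[OF n(1)] fun_upd_same
    by (subst moments_step_pmf) (use n K_nonneg K_sub in \<open>auto simp: transfer_def\<close>)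
  also have "\<dots> = real (R n) * measure_pmf.expectation (run n) (\<lambda>Z. tally Z n (transfer (Suc n) g))"
    by (simp add: sum_distrib_left mult.assoc del: Bochner_Integration.integral_sum
        flip: integral_mult_right_zero)
  finally show ?case
    using Suc.IH[OF n(2)] by (simp add: prior_rep_def mult_ac del: run_pmf.simps)
qed

text \<open>
  If \<open>F\<close> is invariant under the kernels, then \<open>tally Z n (F n) / prior_rep n\<close> is a martingale in \<open>n\<close>,
  so its second moment grows by the mean conditional variance of each generation. The generation
  starting at level \<open>m\<close> is an average over \<open>r\<^sub>m\<close> copies and contributes
  \<open>\<gamma>\<^sub>m(\<Gamma>\<^bsub>m+1\<^esub>(F\<^bsub>m+1\<^esub>)) / r\<^sub>m\<close>.
\<close>

lemma second_moment_tally: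
  assumes F: "\<And>m i. m \<le> L \<Longrightarrow> i \<in> cells L s m \<Longrightarrow> F m i = transfer (Suc m) (F (Suc m)) i"
  shows "n \<le> L + 1 \<Longrightarrow> measure_pmf.expectation (run n) (\<lambda>Z. (tally Z n (F n))\<^sup>2) =
    (prior_rep n)\<^sup>2 * ((F 0 1)\<^sup>2 + (\<Sum>m<n. gamma_val m (noise (Suc m) (F (Suc m))) / prior_rep (Suc m)))"
proof (induction n)
  case 0
  then show ?case by (simp add: prior_rep_def cells_def)
next
  case (Suc n)
  then have n: "n \<le> L" "n \<le> L + 1" by auto
  let ?E = "measure_pmf.expectation" and ?N = "noise (Suc n) (F (Suc n))"
  have "?E (run (Suc n)) (\<lambda>Z. (tally Z (Suc n) (F (Suc n)))\<^sup>2) =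
      ?E (run n) (\<lambda>Z. (\<Sum>i\<in>cells L s n. real (R n * Z n i) * transfer (Suc n) (F (Suc n)) i)\<^sup>2 +
        (\<Sum>i\<in>cells L s n. real (R n * Z n i) * ?N i))"
    unfolding expectation_run_Suc[OF n(1)] fun_upd_same
    by (subst moments_step_pmf) (use n K_nonneg K_sub in \<open>auto simp: transfer_def noise_def\<close>)
  also have "(\<lambda>Z. (\<Sum>i\<in>cells L s n. real (R n * Z n i) * transfer (Suc n) (F (Suc n)) i)\<^sup>2 +
        (\<Sum>i\<in>cells L s n. real (R n * Z n i) * ?N i)) =
      (\<lambda>Z. (real (R n))\<^sup>2 * (tally Z n (F n))\<^sup>2 + real (R n) * tally Z n ?N)"
    by (simp add: F n sum_distrib_left mult.assoc flip: power_mult_distrib)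
  also have "?E (run n) \<dots> =
      (real (R n))\<^sup>2 * ?E (run n) (\<lambda>Z. (tally Z n (F n))\<^sup>2) + real (R n) * ?E (run n) (\<lambda>Z. tally Z n ?N)"
    using n by (subst Bochner_Integration.integral_add) (auto intro!: integrable_run)
  also have "\<dots> = (prior_rep (Suc n))\<^sup>2 *
      ((F 0 1)\<^sup>2 + (\<Sum>m<n. gamma_val m (noise (Suc m) (F (Suc m))) / prior_rep (Suc m)))
      + prior_rep (Suc n) * gamma_val n ?N"
    unfolding Suc.IH[OF n(2)] expectation_tally[OF n(2)]
    by (simp add: prior_rep_def power_mult_distrib mult_ac)
  finally show ?case
    using prior_rep_pos[of "Suc n"] n(1) by (simp add: field_simps power2_eq_square del: run_pmf.simps)
qed

lemma occ_cong:
  assumes "\<And>i. i \<in> cells L s n \<Longrightarrow> g i = h i"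
  shows "gamma_val n g = gamma_val n h"
proof (cases n)
  case 0
  with assms show ?thesis by (simp add: cells_def)
next
  case (Suc m)
  with assms have "transfer n g = transfer n h"
    unfolding transfer_def by (intro ext sum.cong) auto
  with Suc show ?thesis by simp
qed

lemma occ_value:
  assumes F: "\<And>m i. m \<le> L \<Longrightarrow> i \<in> cells L s m \<Longrightarrow> F m i = transfer (Suc m) (F (Suc m)) i"
  shows "n \<le> L + 1 \<Longrightarrow> gamma_val n (F n) = F 0 1"
proof (induction n)
  case (Suc n)
  then have "gamma_val n (transfer (Suc n) (F (Suc n))) = gamma_val n (F n)"
    by (intro occ_cong) (simp add: F)
  with Suc show ?case by simp
qed simp

text \<open>
  The estimator is the terminal value of the martingale of \<open>second_moment_tally\<close>, since \<open>F\<close> is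
  \<open>1\<close> at the target, and \<open>F 0 1\<close> is its mean.
\<close>

theorem estimator_variance_eq:
  assumes F: "\<And>m i. m \<le> L \<Longrightarrow> i \<in> cells L s m \<Longrightarrow> F m i = transfer (Suc m) (F (Suc m)) i"
    and target: "F (L + 1) 1 = 1"
  shows "estimator_variance L s K R =
    (\<Sum>m\<le>L. gamma_val m (noise (Suc m) (F (Suc m))) / real (total_rep R m))"
proof -
  let ?E = "measure_pmf.expectation (run (L + 1))" and ?r = "prior_rep (L + 1)"
  have r: "?r > 0" by (rule prior_rep_pos) simp
  have est: "estimator L R Z = tally Z (L + 1) (F (L + 1)) / ?r" for Z
    using target by (simp add: estimator_def cells_def prior_rep_Suc)
  have mean: "?E (estimator L R) = F 0 1"
    unfolding est using expectation_tally[of "L + 1" "F (L + 1)"] occ_value[of F "L + 1"] F r by simp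
  have "estimator_variance L s K R = ?E (\<lambda>Z. (estimator L R Z)\<^sup>2) - (F 0 1)\<^sup>2"
    unfolding estimator_variance_def algorithm_pmf_def
    by (subst measure_pmf.variance_eq) (auto intro!: integrable_run simp only: mean)
  also have "?E (\<lambda>Z. (estimator L R Z)\<^sup>2) = ?E (\<lambda>Z. (tally Z (L + 1) (F (L + 1)))\<^sup>2) / ?r\<^sup>2"
    unfolding est power_divide by simp
  also have "\<dots> = (F 0 1)\<^sup>2 + (\<Sum>m<L + 1. gamma_val m (noise (Suc m) (F (Suc m))) / prior_rep (Suc m))"
    using second_moment_tally[of F "L + 1"] F r by simp
  finally show ?thesis
    by (simp add: prior_rep_Suc lessThan_Suc_atMost)
qed

theorem mean_cost_eq:
  "mean_cost L s K R u = (\<Sum>n\<le>L. real (total_rep R n) * gamma_val n (u n))"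
proof -
  let ?E = "measure_pmf.expectation (run (L + 1))"
  have "mean_cost L s K R u = ?E (\<lambda>Z. \<Sum>n\<le>L. real (R n) * tally Z n (u n))"
    by (simp add: mean_cost_def algorithm_pmf_def sum_distrib_left mult.assoc del: run_pmf.simps)
  also have "\<dots> = (\<Sum>n\<le>L. real (R n) * ?E (\<lambda>Z. tally Z n (u n)))"
    by (subst Bochner_Integration.integral_sum) (auto intro!: integrable_run simp del: run_pmf.simps)
  also have "\<dots> = (\<Sum>n\<le>L. real (R n) * (prior_rep n * gamma_val n (u n)))"
  proof (intro sum.cong refl arg_cong2[where f = "(*)"])
    fix n assume "n \<in> {..L}"
    then have n: "n \<le> L + 1" by simp
    show "?E (\<lambda>Z. tally Z n (u n)) = prior_rep n * gamma_val n (u n)"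
      using expectation_run_earlier[OF n order_refl, of "\<lambda>z. \<Sum>i\<in>cells L s n. real (z i) * u n i"]
        expectation_tally[OF n] by (simp del: run_pmf.simps)
  qed
  finally show ?thesis
    by (simp flip: prior_rep_Suc) (simp add: prior_rep_def mult_ac)
qed

end

section \<open>Reaching probabilities and success probabilities\<close>

context splitting_model
begin

definition agrees :: "nat \<Rightarrow> (nat \<Rightarrow> nat option) \<Rightarrow> 'w \<Rightarrow> bool" where
  "agrees k h \<omega> \<longleftrightarrow> (\<forall>m\<le>k. embedded S m \<omega> = h m)"

definition success :: "'w \<Rightarrow> bool" where
  "success \<omega> \<longleftrightarrow> hit_time S (nthr S + 1) \<omega> < \<infinity>"

text \<open>
  The weight \<open>w\<close> is the conditional probability of success after any history that ends in
  the given cell. Quantifying over whole histories, rather than over the current cell alone, is what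
  makes the property pass from one level to the previous one: the Markov assumption conditions on
  histories. The product form also covers histories of probability \<open>0\<close>.
\<close>

definition predicts_success :: "nat \<Rightarrow> (nat \<Rightarrow> real) \<Rightarrow> bool" where
  "predicts_success k w \<longleftrightarrow> (\<forall>h i. h k = Some i \<longrightarrow>
     \<P>(\<omega> in probsp S. success \<omega> \<and> agrees k h \<omega>) = w i * \<P>(\<omega> in probsp S. agrees k h \<omega>))"

lemma embedded_eq_Some: "embedded S k \<omega> = Some i \<longleftrightarrow> hit_time S k \<omega> < \<infinity> \<and> hit_cell S k \<omega> = i"
  by (simp add: embedded_def)

lemma hit_time_mono:
  assumes "k \<le> m" "m \<le> nthr S + 1" "\<omega> \<in> space (probsp S)"
  shows "hit_time S k \<omega> \<le> hit_time S m \<omega>"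
  using assms(1,2)
proof (induction m rule: dec_induct)
  case (step m)
  have "hit_time S m \<omega> \<le> hit_time S (m + 1) \<omega>"
  proof (cases "m = 0")
    case True
    then show ?thesis
      using hit_time_0[OF assms(3)] by (auto simp: hit_time_def intro!: Inf_greatest)
  next
    case False
    with step.prems show ?thesis by (intro ordered assms(3)) auto
  qed
  with step show ?case by (simp add: order_trans[of "hit_time S k \<omega>"])
qed simp

lemma embedded_earlier:
  assumes "embedded S m \<omega> \<noteq> None" "k \<le> m" "m \<le> nthr S + 1" "\<omega> \<in> space (probsp S)"
  shows "embedded S k \<omega> \<noteq> None"
  using assms(1) hit_time_mono[OF assms(2,3,4)] by (auto simp: embedded_def split: if_splits)

lemma hit_cell_in_scells:
  assumes "k \<le> nthr S + 1" "\<omega> \<in> space (probsp S)" "hit_time S k \<omega> < \<infinity>"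
  shows "hit_cell S k \<omega> \<in> scells S k"
proof -
  consider "k = 0" | "1 \<le> k" "k \<le> nthr S" | "k = nthr S + 1" using assms(1) by linarith
  then show ?thesis
    using assms hit_cell_0[of \<omega>] hit_cell_last[of \<omega>] hit_cell_mem(1)[of k \<omega>]
    by cases (auto simp: cells_def)
qed

lemma embedded_range:
  assumes "k \<le> nthr S + 1" "\<omega> \<in> space (probsp S)"
  shows "embedded S k \<omega> \<in> insert None (Some ` scells S k)"
  using hit_cell_in_scells[OF assms] by (auto simp: embedded_def)

lemma measurable_embedded [measurable (raw)]:
  assumes "k \<le> nthr S + 1"
  shows "embedded S k \<in> measurable (probsp S) (count_space UNIV)"
proof (subst measurable_count_space_eq_countable[OF countableI_type], intro conjI ballI)
  have ev: "embedded S k -` {Some i} \<inter> space (probsp S) \<in> events" for i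
    using embedded_measurable[OF assms, of i] by (simp add: vimage_def Int_def conj_commute)
  have none: "embedded S k -` {None} \<inter> space (probsp S) =
      space (probsp S) - (\<Union>i. embedded S k -` {Some i} \<inter> space (probsp S))"
    by auto
  show "embedded S k -` {x} \<inter> space (probsp S) \<in> events" for x
  proof (cases x)
    case None
    then show ?thesis
      by (simp only: none) (intro sets.Diff sets.top sets.countable_UN image_subsetI ev)
  qed (simp add: ev)
qed auto

lemma event_agrees: "k \<le> nthr S + 1 \<Longrightarrow> {\<omega> \<in> space (probsp S). agrees k h \<omega>} \<in> events"
  unfolding agrees_def by measurable

lemma success_iff: "success \<omega> \<longleftrightarrow> embedded S (nthr S + 1) \<omega> \<noteq> None"
  by (simp add: success_def embedded_def)

lemma event_success: "{\<omega> \<in> space (probsp S). success \<omega>} \<in> events"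
  unfolding success_iff by measurable

lemma event_embedded: "k \<le> nthr S + 1 \<Longrightarrow> {\<omega> \<in> space (probsp S). embedded S k \<omega> = x} \<in> events"
  by measurable

lemmas events = event_agrees event_success event_embedded sets.sets_Collect_conj

lemma gam_eq: "gam S k i = \<P>(\<omega> in probsp S. embedded S k \<omega> = Some i)"
  by (simp add: gam_def embedded_eq_Some)

lemma kern_eq: "kern S (Suc k) i j =
    \<P>(\<omega> in probsp S. embedded S (Suc k) \<omega> = Some j \<bar> embedded S k \<omega> = Some i)"
  by (simp add: kern_def embedded_eq_Some)

text \<open>
  Both sides vanish at cells of probability \<open>0\<close>, where the conditional probability has its default
  value.
\<close>

lemma gam_times_kern:
  assumes "k \<le> nthr S"
  shows "gam S k i * kern S (Suc k) i j =
    \<P>(\<omega> in probsp S. embedded S (Suc k) \<omega> = Some j \<and> embedded S k \<omega> = Some i)"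
proof (cases "gam S k i = 0")
  case True
  have "\<P>(\<omega> in probsp S. embedded S (Suc k) \<omega> = Some j \<and> embedded S k \<omega> = Some i) \<le> gam S k i"
    unfolding gam_eq using assms by (intro finite_measure_mono events) auto
  with True show ?thesis by (simp add: measure_le_0_iff)
qed (simp add: kern_eq cond_prob_def gam_eq)

lemma kern_nonneg: "0 \<le> kern S k i j"
  by (simp add: kern_def cond_prob_def)

lemma kern_eq_0:
  assumes "k \<le> nthr S" "gam S (Suc k) j = 0"
  shows "kern S (Suc k) i j = 0"
proof -
  have "\<P>(\<omega> in probsp S. embedded S (Suc k) \<omega> = Some j \<and> embedded S k \<omega> = Some i) \<le> gam S (Suc k) j"
    unfolding gam_eq using assms by (intro finite_measure_mono events) auto
  with assms(2) show ?thesis by (simp add: kern_eq cond_prob_def measure_le_0_iff)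
qed

lemma kern_sum_le_1:
  assumes "k \<le> nthr S"
  shows "(\<Sum>j\<in>scells S (Suc k). kern S (Suc k) i j) \<le> 1"
proof (cases "gam S k i = 0")
  case True
  then show ?thesis by (simp add: kern_eq cond_prob_def flip: gam_eq)
next
  case False
  have "gam S k i * (\<Sum>j\<in>scells S (Suc k). kern S (Suc k) i j) =
      \<P>(\<omega> in probsp S. embedded S (Suc k) \<omega> \<noteq> None \<and> embedded S k \<omega> = Some i)"
    unfolding sum_distrib_left gam_times_kern[OF assms]
  proof (rule prob_sum[symmetric])
    show "AE \<omega> in probsp S. (\<forall>j\<in>scells S (Suc k). embedded S (Suc k) \<omega> = Some j \<and> embedded S k \<omega> = Some i \<longrightarrow>
        embedded S (Suc k) \<omega> \<noteq> None \<and> embedded S k \<omega> = Some i) \<and>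
        (embedded S (Suc k) \<omega> \<noteq> None \<and> embedded S k \<omega> = Some i \<longrightarrow>
        (\<exists>!j. j \<in> scells S (Suc k) \<and> embedded S (Suc k) \<omega> = Some j \<and> embedded S k \<omega> = Some i))"
      using embedded_range[of "Suc k"] assms by (intro AE_I2) fastforce
    show "{\<omega> \<in> space (probsp S). embedded S (Suc k) \<omega> \<noteq> None \<and> embedded S k \<omega> = Some i} \<in> events"
    proof -
      have [measurable]: "Suc k \<le> nthr S + 1" "k \<le> nthr S + 1" using assms by auto
      show ?thesis by measurable
    qed
  qed (use assms in \<open>auto intro!: events\<close>)
  also have "\<dots> \<le> gam S k i"
    unfolding gam_eq using assms by (intro finite_measure_mono events) auto
  finally show ?thesis
    using False by (simp add: gam_eq measure_le_0_iff order.strict_iff_order)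
qed

text \<open>
  Since the thresholds are hit in order, a particle that reaches level \<open>k + 1\<close> has passed through
  exactly one cell of level \<open>k\<close>.
\<close>

lemma gam_Suc:
  assumes "k \<le> nthr S"
  shows "gam S (Suc k) j = (\<Sum>i\<in>scells S k. gam S k i * kern S (Suc k) i j)"
  unfolding gam_times_kern[OF assms] gam_eq[of "Suc k"]
proof (rule prob_sum)
  show "AE \<omega> in probsp S. (\<forall>i\<in>scells S k. embedded S (Suc k) \<omega> = Some j \<and> embedded S k \<omega> = Some i \<longrightarrow>
      embedded S (Suc k) \<omega> = Some j) \<and> (embedded S (Suc k) \<omega> = Some j \<longrightarrow>
      (\<exists>!i. i \<in> scells S k \<and> embedded S (Suc k) \<omega> = Some j \<and> embedded S k \<omega> = Some i))"
  proof (rule AE_I2)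
    fix \<omega> assume \<omega>: "\<omega> \<in> space (probsp S)"
    show "(\<forall>i\<in>scells S k. embedded S (Suc k) \<omega> = Some j \<and> embedded S k \<omega> = Some i \<longrightarrow>
      embedded S (Suc k) \<omega> = Some j) \<and> (embedded S (Suc k) \<omega> = Some j \<longrightarrow>
      (\<exists>!i. i \<in> scells S k \<and> embedded S (Suc k) \<omega> = Some j \<and> embedded S k \<omega> = Some i))"
      using embedded_earlier[of "Suc k" \<omega> k] embedded_range[of k \<omega>] \<omega> assms by auto
  qed
qed (use assms in \<open>auto simp: cells_def intro!: events\<close>)

lemma gam_int_Suc:
  assumes "k \<le> nthr S"
  shows "gam_int S (Suc k) g = gam_int S k (kern_op S (Suc k) g)"
  unfolding gam_int_def kern_op_def gam_Suc[OF assms] sum_distrib_left sum_distrib_right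
  by (subst sum.swap) (simp add: mult.assoc)

lemma gam_int_0: "gam_int S 0 g = g 1"
  by (simp add: gam_int_def cells_def gam_0[simplified])

lemma predicts_success_last: "predicts_success (nthr S + 1) (\<lambda>_. 1)"
  unfolding predicts_success_def
proof (intro allI impI)
  fix h :: "nat \<Rightarrow> nat option" and i assume "h (nthr S + 1) = Some i"
  then have "success \<omega> \<and> agrees (nthr S + 1) h \<omega> \<longleftrightarrow> agrees (nthr S + 1) h \<omega>" for \<omega>
    by (auto simp: success_iff agrees_def)
  then show "\<P>(\<omega> in probsp S. success \<omega> \<and> agrees (nthr S + 1) h \<omega>) =
      1 * \<P>(\<omega> in probsp S. agrees (nthr S + 1) h \<omega>)" by simp
qed

lemma prob_agrees_Suc:
  assumes k: "k \<le> nthr S" and i: "h k = Some i"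
  shows "\<P>(\<omega> in probsp S. agrees (Suc k) (h(Suc k := Some j)) \<omega>) =
    kern S (Suc k) i j * \<P>(\<omega> in probsp S. agrees k h \<omega>)"
proof -
  have ext: "agrees (Suc k) (h(Suc k := x)) \<omega> \<longleftrightarrow> embedded S (Suc k) \<omega> = x \<and> agrees k h \<omega>" for x \<omega>
    by (auto simp: agrees_def le_Suc_eq)
  show ?thesis
  proof (cases "\<P>(\<omega> in probsp S. agrees k h \<omega>) = 0")
    case True
    have "\<P>(\<omega> in probsp S. agrees (Suc k) (h(Suc k := Some j)) \<omega>) \<le> \<P>(\<omega> in probsp S. agrees k h \<omega>)"
      using k by (intro finite_measure_mono events) (auto simp: ext)
    with True show ?thesis by (simp add: measure_le_0_iff)
  next
    case False
    then have "\<P>(\<omega> in probsp S. embedded S (Suc k) \<omega> = Some j \<bar> agrees k h \<omega>) = kern S (Suc k) i j"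
      unfolding kern_eq using markov[OF k, of h "Some j"] i by (simp add: agrees_def)
    with False show ?thesis by (simp add: ext cond_prob_def field_simps)
  qed
qed

text \<open>
  Split according to the cell of level \<open>k + 1\<close>. A successful particle is not killed there, and each
  extended history has its probability multiplied by the corresponding entry of the kernel.
\<close>

lemma predicts_success_step:
  assumes k: "k \<le> nthr S" and w: "predicts_success (Suc k) w"
  shows "predicts_success k (kern_op S (Suc k) w)"
  unfolding predicts_success_def
proof (intro allI impI)
  fix h :: "nat \<Rightarrow> nat option" and i assume i: "h k = Some i"
  let ?h = "\<lambda>j. h(Suc k := Some j)"
  have ext: "agrees (Suc k) (?h j) \<omega> \<longleftrightarrow> embedded S (Suc k) \<omega> = Some j \<and> agrees k h \<omega>" for j \<omega>
    by (auto simp: agrees_def le_Suc_eq)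
  have "\<P>(\<omega> in probsp S. success \<omega> \<and> agrees k h \<omega>) =
      (\<Sum>j\<in>scells S (Suc k). \<P>(\<omega> in probsp S. success \<omega> \<and> agrees (Suc k) (?h j) \<omega>))"
  proof (rule prob_sum)
    show "AE \<omega> in probsp S. (\<forall>j\<in>scells S (Suc k). success \<omega> \<and> agrees (Suc k) (?h j) \<omega> \<longrightarrow>
        success \<omega> \<and> agrees k h \<omega>) \<and> (success \<omega> \<and> agrees k h \<omega> \<longrightarrow>
        (\<exists>!j. j \<in> scells S (Suc k) \<and> success \<omega> \<and> agrees (Suc k) (?h j) \<omega>))"
    proof (rule AE_I2)
      fix \<omega> assume \<omega>: "\<omega> \<in> space (probsp S)"
      have "\<exists>j\<in>scells S (Suc k). embedded S (Suc k) \<omega> = Some j" if "success \<omega>"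
        using that embedded_earlier[of "nthr S + 1" \<omega> "Suc k"] embedded_range[of "Suc k" \<omega>] k \<omega>
        by (auto simp: success_iff)
      then show "(\<forall>j\<in>scells S (Suc k). success \<omega> \<and> agrees (Suc k) (?h j) \<omega> \<longrightarrow>
        success \<omega> \<and> agrees k h \<omega>) \<and> (success \<omega> \<and> agrees k h \<omega> \<longrightarrow>
        (\<exists>!j. j \<in> scells S (Suc k) \<and> success \<omega> \<and> agrees (Suc k) (?h j) \<omega>))"
        unfolding ext by auto
    qed
  qed (use k in \<open>auto simp: cells_def intro!: events\<close>)
  also have "\<dots> = (\<Sum>j\<in>scells S (Suc k). w j * \<P>(\<omega> in probsp S. agrees (Suc k) (?h j) \<omega>))"
    using w unfolding predicts_success_def by (intro sum.cong refl) auto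
  also have "\<dots> = kern_op S (Suc k) w i * \<P>(\<omega> in probsp S. agrees k h \<omega>)"
    unfolding prob_agrees_Suc[of k h i, OF k i] by (simp add: kern_op_def sum_distrib_left sum_distrib_right mult_ac)
  finally show "\<P>(\<omega> in probsp S. success \<omega> \<and> agrees k h \<omega>) =
    kern_op S (Suc k) w i * \<P>(\<omega> in probsp S. agrees k h \<omega>)" .
qed

lemma ex_predicts_success: "k \<le> nthr S + 1 \<Longrightarrow> \<exists>w. predicts_success k w"
proof (induction k rule: inc_induct)
  case base
  show ?case using predicts_success_last by blast
next
  case (step k)
  then show ?case using predicts_success_step[of k] by (auto simp: less_Suc_eq_le)
qed

text \<open>
  Up to level \<open>k\<close> there are only finitely many histories, so conditioning on the current cell
  averages over the histories leading to it.
\<close>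

lemma prob_sum_histories:
  assumes k: "k \<le> nthr S + 1" and E: "{\<omega> \<in> space (probsp S). E \<omega>} \<in> events"
  shows "\<P>(\<omega> in probsp S. E \<omega> \<and> embedded S k \<omega> = Some i) =
    (\<Sum>h\<in>{h \<in> PiE {..k} (\<lambda>m. insert None (Some ` scells S m)). h k = Some i}.
      \<P>(\<omega> in probsp S. E \<omega> \<and> agrees k h \<omega>))"
    (is "_ = (\<Sum>h\<in>?H. _)")
proof (rule prob_sum)
  show "finite ?H"
    by (intro finite_Collect_conjI disjI1) (simp only: Collect_mem_eq, intro finite_PiE, simp_all)
  show "AE \<omega> in probsp S. (\<forall>h\<in>?H. E \<omega> \<and> agrees k h \<omega> \<longrightarrow> E \<omega> \<and> embedded S k \<omega> = Some i) \<and>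
      (E \<omega> \<and> embedded S k \<omega> = Some i \<longrightarrow> (\<exists>!h. h \<in> ?H \<and> E \<omega> \<and> agrees k h \<omega>))"
  proof (rule AE_I2, intro conjI ballI impI)
    fix \<omega> h assume "h \<in> ?H" "E \<omega> \<and> agrees k h \<omega>"
    then show "E \<omega>" "embedded S k \<omega> = Some i" by (auto simp: agrees_def)
  next
    fix \<omega> assume \<omega>: "\<omega> \<in> space (probsp S)" and "E \<omega> \<and> embedded S k \<omega> = Some i"
    moreover have "embedded S m \<omega> \<in> insert None (Some ` scells S m)" if "m \<le> k" for m
      using embedded_range[of m \<omega>] that k \<omega> by simp
    ultimately show "\<exists>!h. h \<in> ?H \<and> E \<omega> \<and> agrees k h \<omega>"
      by (intro ex1I[of _ "\<lambda>m\<in>{..k}. embedded S m \<omega>"])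
        (auto simp: agrees_def PiE_def extensional_def fun_eq_iff)
  qed
qed (use k E in \<open>auto intro!: events\<close>)

lemma predicts_success_target_prob:
  assumes k: "k \<le> nthr S + 1" and w: "predicts_success k w" and i: "gam S k i \<noteq> 0"
  shows "target_prob S k i = w i"
proof -
  let ?H = "{h \<in> PiE {..k} (\<lambda>m. insert None (Some ` scells S m)). h k = Some i}"
  have "\<P>(\<omega> in probsp S. success \<omega> \<and> embedded S k \<omega> = Some i) =
      (\<Sum>h\<in>?H. \<P>(\<omega> in probsp S. success \<omega> \<and> agrees k h \<omega>))"
    using k by (intro prob_sum_histories events)
  also have "\<dots> = (\<Sum>h\<in>?H. w i * \<P>(\<omega> in probsp S. True \<and> agrees k h \<omega>))"
    using w by (intro sum.cong refl) (auto simp: predicts_success_def)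
  also have "\<dots> = w i * \<P>(\<omega> in probsp S. True \<and> embedded S k \<omega> = Some i)"
    unfolding sum_distrib_left[symmetric] using k by (subst prob_sum_histories) auto
  finally show ?thesis
    using i by (simp add: target_prob_def cond_prob_def success_def embedded_eq_Some gam_def)
qed

lemma target_prob_null: "gam S k i = 0 \<Longrightarrow> target_prob S k i = 0"
  by (simp add: target_prob_def cond_prob_def gam_def)

text \<open>
  The functions \<open>f\<^sub>k\<close> satisfy \<open>f\<^sub>k = P\<^bsub>k+1\<^esub>(f\<^bsub>k+1\<^esub>)\<close>. The equation holds at every \<open>i\<close>, including the cells of
  probability \<open>0\<close>, where the default values make both sides \<open>0\<close>; hence these cells need no special
  treatment in the variance formulas.
\<close>

lemma target_prob_step:
  assumes k: "k \<le> nthr S"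
  shows "target_prob S k i = kern_op S (Suc k) (target_prob S (Suc k)) i"
proof (cases "gam S k i = 0")
  case True
  then have "kern S (Suc k) i j = 0" for j
    by (simp add: kern_eq cond_prob_def flip: gam_eq)
  with True show ?thesis by (simp add: kern_op_def target_prob_null)
next
  case False
  obtain w where w: "predicts_success (Suc k) w"
    using ex_predicts_success[of "Suc k"] k by auto
  have "target_prob S k i = kern_op S (Suc k) w i"
    using predicts_success_target_prob[OF _ predicts_success_step[OF k w] False] k by simp
  also have "\<dots> = kern_op S (Suc k) (target_prob S (Suc k)) i"
    unfolding kern_op_def
  proof (intro sum.cong refl)
    fix j
    show "kern S (Suc k) i j * w j = kern S (Suc k) i j * target_prob S (Suc k) j"
      using predicts_success_target_prob[OF _ w, of j] kern_eq_0[OF k, of j i] k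
      by (cases "gam S (Suc k) j = 0") auto
  qed
  finally show ?thesis .
qed

end

section \<open>Deleting a threshold\<close>

lemma sum_thresholds_split:
  fixes f :: "nat \<Rightarrow> real"
  assumes "1 \<le> k" "k \<le> M"
  shows "(\<Sum>m\<le>M. f m) = (\<Sum>m<k-1. f m) + f (k - 1) + f k + (\<Sum>m=k+1..M. f m)"
  using assms(2,1)
proof (induction M rule: dec_induct)
  case base
  then show ?case by (cases k) (simp_all flip: lessThan_Suc_atMost)
qed simp

lemma sum_thresholds_split_deleted:
  fixes f :: "nat \<Rightarrow> real"
  assumes "1 \<le> k" "k \<le> M"
  shows "(\<Sum>m\<le>M-1. f m) = (\<Sum>m<k-1. f m) + f (k - 1) + (\<Sum>m=k+1..M. f (m - 1))"
  using assms(2,1)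
proof (induction M rule: dec_induct)
  case base
  then show ?case by (cases k) (simp_all flip: lessThan_Suc_atMost)
next
  case (step M)
  then have "(\<Sum>m\<le>Suc M - 1. f m) = (\<Sum>m\<le>M - 1. f m) + f M" by (cases M) auto
  with step show ?case by simp
qed

context splitting_model
begin

lemma splitting_scheme_kern:
  assumes "\<And>n. n \<le> nthr S \<Longrightarrow> R n \<ge> 1"
  shows "splitting_scheme (nthr S) (ncell S) (kern S) R"
  using assms kern_nonneg kern_sum_le_1 by unfold_locales

lemma variance_and_cost_kern:
  assumes R: "\<forall>n\<le>nthr S. R n \<ge> 1" and p: "gam S (nthr S + 1) 1 \<noteq> 0"
  shows "estimator_variance (nthr S) (ncell S) (kern S) R =
    (\<Sum>m\<le>nthr S. gam_int S m (Gamma_op S (m + 1) (target_prob S (m + 1))) / real (total_rep R m))"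
    and "mean_cost (nthr S) (ncell S) (kern S) R u =
    (\<Sum>n\<le>nthr S. real (total_rep R n) * gam_int S n (u n))"
proof -
  interpret sch: splitting_scheme "nthr S" "ncell S" "kern S" R
    using R by (intro splitting_scheme_kern) simp
  have tr: "sch.transfer n = kern_op S n" for n
    by (intro ext) (simp add: sch.transfer_def kern_op_def)
  have noise: "sch.noise n = Gamma_op S n" for n
    by (intro ext) (simp add: sch.noise_def tr Gamma_op_def)
  have occ: "sch.gamma_val n g = gam_int S n g" if "n \<le> nthr S + 1" for n g
    using that by (induction n arbitrary: g) (simp_all add: gam_int_0[simplified] gam_int_Suc tr)
  show "estimator_variance (nthr S) (ncell S) (kern S) R =
    (\<Sum>m\<le>nthr S. gam_int S m (Gamma_op S (m + 1) (target_prob S (m + 1))) / real (total_rep R m))"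
    by (subst sch.estimator_variance_eq[of "target_prob S"])
       (use p in \<open>auto simp: tr noise occ target_prob_step target_prob_last[simplified]\<close>)
  show "mean_cost (nthr S) (ncell S) (kern S) R u =
    (\<Sum>n\<le>nthr S. real (total_rep R n) * gam_int S n (u n))"
    by (simp add: sch.mean_cost_eq occ)
qed

definition old_level :: "nat \<Rightarrow> nat \<Rightarrow> nat" where
  "old_level k n = (if n < k then n else n + 1)"

text \<open>
  The target level \<open>nthr S\<close> of the shortened algorithm is the old target level, so the single-cell
  convention for the end levels agrees in the two numberings.
\<close>

lemma cells_deleted:
  "1 \<le> k \<Longrightarrow> k \<le> nthr S \<Longrightarrow> cells (nthr S - 1) (ncell S) n = scells S (old_level k n)"
  by (auto simp: cells_def old_level_def)

lemma sum_del_kern_op: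
  assumes "1 \<le> k" "k \<le> nthr S"
  shows "(\<Sum>j\<in>scells S (old_level k n). del_kern S k n i j * g j) =
    (if n = k then kern_op S k (kern_op S (k + 1) g) i else kern_op S (old_level k n) g i)"
proof (cases "n = k")
  case True
  have "(\<Sum>j\<in>scells S (k + 1). (\<Sum>l\<in>scells S k. kern S k i l * kern S (k + 1) l j) * g j) =
      (\<Sum>j\<in>scells S (k + 1). \<Sum>l\<in>scells S k. kern S k i l * (kern S (k + 1) l j * g j))"
    by (simp add: sum_distrib_right mult.assoc)
  also have "\<dots> = kern_op S k (kern_op S (k + 1) g) i"
    by (subst sum.swap) (simp add: kern_op_def sum_distrib_left)
  finally show ?thesis using True by (simp add: del_kern_def old_level_def)
next
  case False
  then show ?thesis by (simp add: del_kern_def old_level_def kern_op_def)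
qed

lemma kern_op_mono:
  "(\<And>j. j \<in> scells S n \<Longrightarrow> g j \<le> h j) \<Longrightarrow> kern_op S n g i \<le> kern_op S n h i"
  unfolding kern_op_def by (intro sum_mono mult_left_mono kern_nonneg)

lemma kern_op_one_le_1: "1 \<le> n \<Longrightarrow> n \<le> nthr S + 1 \<Longrightarrow> kern_op S n (\<lambda>_. 1) i \<le> 1"
  using kern_sum_le_1[of "n - 1" i] by (simp add: kern_op_def)

lemma splitting_scheme_del_kern:
  assumes k: "1 \<le> k" "k \<le> nthr S" and R: "\<And>n. n \<le> nthr S - 1 \<Longrightarrow> R n \<ge> 1"
  shows "splitting_scheme (nthr S - 1) (ncell S) (del_kern S k) R"
proof
  fix n i assume n: "n \<le> nthr S - 1"
  show "0 \<le> del_kern S k (Suc n) i j" for j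
    by (auto simp: del_kern_def intro!: kern_nonneg sum_nonneg mult_nonneg_nonneg)
  have "kern_op S k (kern_op S (k + 1) (\<lambda>_. 1)) i \<le> kern_op S k (\<lambda>_. 1) i"
    using k by (intro kern_op_mono kern_op_one_le_1) auto
  also have "\<dots> \<le> 1" using k by (intro kern_op_one_le_1) auto
  finally show "(\<Sum>j\<in>cells (nthr S - 1) (ncell S) (Suc n). del_kern S k (Suc n) i j) \<le> 1"
    using sum_del_kern_op[OF k, of "Suc n" i "\<lambda>_. 1"] n k kern_op_one_le_1[of "old_level k (Suc n)" i]
    unfolding cells_deleted[OF k] by (auto simp: old_level_def split: if_splits)
qed (use R in auto)

text \<open>
  Law of total variance for the two-step transition across the deleted threshold: the variance is the
  mean of the variance of the second step plus the variance of the conditional mean after the first.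
\<close>

lemma Gamma_op_compose:
  "kern_op S k (kern_op S (k + 1) (\<lambda>j. (g j)\<^sup>2)) i - (kern_op S k (kern_op S (k + 1) g) i)\<^sup>2 =
    kern_op S k (Gamma_op S (k + 1) g) i + Gamma_op S k (kern_op S (k + 1) g) i"
  by (simp add: Gamma_op_def kern_op_def[of S k] right_diff_distrib sum_subtractf)

lemma gam_int_add: "gam_int S n (\<lambda>i. g i + h i) = gam_int S n g + gam_int S n h"
  by (simp add: gam_int_def distrib_left sum.distrib)

text \<open>
  Compared with the full algorithm, levels \<open>k - 1\<close> and \<open>k\<close> are merged. By \<open>Gamma_op_compose\<close> the
  merged step carries the two terms \<open>v (k - 1)\<close> and \<open>v k\<close>, now with a common weight, and all other
  terms stay the same up to the renumbering; the cost simply loses the term of level \<open>k\<close>.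
\<close>

lemma variance_and_cost_del_kern:
  assumes k: "1 \<le> k" "k \<le> nthr S" and R: "\<forall>n\<le>nthr S - 1. R n \<ge> 1"
    and p: "gam S (nthr S + 1) 1 \<noteq> 0"
  defines "v \<equiv> \<lambda>m. gam_int S m (Gamma_op S (m + 1) (target_prob S (m + 1)))"
  shows "estimator_variance (nthr S - 1) (ncell S) (del_kern S k) R =
      (\<Sum>m<k-1. v m / real (total_rep R m)) + (v (k - 1) + v k) / real (total_rep R (k - 1))
      + (\<Sum>m=k+1..nthr S. v m / real (total_rep R (m - 1)))"
    and "mean_cost (nthr S - 1) (ncell S) (del_kern S k) R u =
      (\<Sum>n<k-1. real (total_rep R n) * gam_int S n (u n))
      + real (total_rep R (k - 1)) * gam_int S (k - 1) (u (k - 1))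
      + (\<Sum>n=k+1..nthr S. real (total_rep R (n - 1)) * gam_int S n (u (n - 1)))"
proof -
  define L where "L = nthr S - 1"
  have Suc_L: "L + 1 = nthr S" using k by (simp add: L_def)
  interpret sch: splitting_scheme L "ncell S" "del_kern S k" R
    unfolding L_def using k R by (intro splitting_scheme_del_kern) simp_all
  define F where "F n = target_prob S (old_level k n)" for n
  have tr: "sch.transfer n g i =
      (if n = k then kern_op S k (kern_op S (k + 1) g) i else kern_op S (old_level k n) g i)" for n g i
    unfolding sch.transfer_def cells_deleted[OF k, folded L_def] by (rule sum_del_kern_op[OF k])
  have occ: "sch.gamma_val n g = gam_int S (old_level k n) g" if "n \<le> nthr S" for n g
    using that
  proof (induction n arbitrary: g)
    case 0
    show ?case using k unfolding sch.gamma_val.simps by (simp add: old_level_def gam_int_0[simplified])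
  next
    case (Suc n)
    consider "Suc n < k" | "Suc n = k" | "k < Suc n" by linarith
    then show ?case
      using Suc k
    proof cases
      case 1
      then have "sch.transfer (Suc n) g = kern_op S (Suc n) g"
        by (intro ext) (simp add: tr old_level_def)
      with 1 Suc show ?thesis by (simp add: old_level_def gam_int_Suc)
    next
      case 2
      then have "sch.transfer (Suc n) g = kern_op S (Suc n) (kern_op S (Suc (Suc n)) g)"
        by (intro ext) (simp add: tr)
      moreover have "sch.gamma_val n h = gam_int S n h" for h
        using 2 Suc by (simp add: old_level_def)
      ultimately have "sch.gamma_val (Suc n) g = gam_int S (Suc (Suc n)) g"
        using gam_int_Suc[of n "kern_op S (Suc (Suc n)) g"] gam_int_Suc[of "Suc n" g] 2 k
        unfolding sch.gamma_val.simps by simp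
      with 2 show ?thesis by (simp add: old_level_def)
    next
      case 3
      then have "sch.transfer (Suc n) g = kern_op S (Suc (Suc n)) g"
        by (intro ext) (simp add: tr old_level_def)
      with 3 Suc show ?thesis by (simp add: old_level_def gam_int_Suc)
    qed
  qed
  have target_k: "target_prob S k = kern_op S (k + 1) (target_prob S (k + 1))"
    using target_prob_step k by (intro ext) simp
  have F: "F m i = sch.transfer (Suc m) (F (Suc m)) i" if "m \<le> L" for m i
  proof -
    consider "Suc m < k" | "Suc m = k" | "k < Suc m" by linarith
    then show ?thesis
    proof cases
      case 2
      then have "F m i = kern_op S k (target_prob S k) i"
        using target_prob_step[of m i] k by (auto simp: F_def old_level_def)
      with 2 show ?thesis by (simp add: tr F_def old_level_def target_k)
    qed (use that Suc_L in \<open>auto simp: tr F_def old_level_def target_prob_step\<close>)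
  qed
  have noise: "sch.noise n (F n) = Gamma_op S (old_level k n) (target_prob S (old_level k n))" if "n \<noteq> k" for n
    using that by (intro ext) (simp add: sch.noise_def tr Gamma_op_def F_def)
  have noise_k: "sch.noise k (F k) = (\<lambda>i. kern_op S k (Gamma_op S (k + 1) (target_prob S (k + 1))) i
      + Gamma_op S k (target_prob S k) i)"
    unfolding sch.noise_def tr target_k
    using Gamma_op_compose[of k "target_prob S (k + 1)"] by (auto simp: F_def old_level_def)
  have "sch.gamma_val (k - 1) (sch.noise k (F k)) = gam_int S (k - 1) (kern_op S k (Gamma_op S (k + 1) (target_prob S (k + 1))))
      + v (k - 1)"
    using k by (simp add: occ old_level_def noise_k gam_int_add v_def)
  also have "gam_int S (k - 1) (kern_op S k (Gamma_op S (k + 1) (target_prob S (k + 1)))) = v k"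
    using gam_int_Suc[of "k - 1"] k by (simp add: v_def)
  finally have mid: "sch.gamma_val (k - 1) (sch.noise (Suc (k - 1)) (F (Suc (k - 1)))) = v (k - 1) + v k"
    using k by simp
  have low: "sch.gamma_val m (sch.noise (Suc m) (F (Suc m))) = v m" if "m < k - 1" for m
    using that k by (auto simp add: occ noise old_level_def v_def)
  have high: "sch.gamma_val (m - 1) (sch.noise (Suc (m - 1)) (F (Suc (m - 1)))) = v m"
    if m: "m \<in> {k+1..nthr S}" for m
  proof -
    have "Suc (m - 1) = m" using m by simp
    then show ?thesis
      using m k by (auto simp: occ noise old_level_def v_def)
  qed
  have split: "(\<Sum>m\<le>L. f m) = (\<Sum>m<k-1. f m) + f (k - 1) + (\<Sum>m=k+1..nthr S. f (m - 1))"
    for f :: "nat \<Rightarrow> real"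
    unfolding L_def by (rule sum_thresholds_split_deleted[OF k])
  have "F (L + 1) 1 = 1"
    unfolding Suc_L using k p target_prob_last by (simp add: F_def old_level_def)
  then have "estimator_variance L (ncell S) (del_kern S k) R =
      (\<Sum>m\<le>L. sch.gamma_val m (sch.noise (Suc m) (F (Suc m))) / real (total_rep R m))"
    using F by (intro sch.estimator_variance_eq) auto
  also have "\<dots> = (\<Sum>m<k-1. v m / real (total_rep R m)) + (v (k - 1) + v k) / real (total_rep R (k - 1))
      + (\<Sum>m=k+1..nthr S. v m / real (total_rep R (m - 1)))"
    unfolding split mid by (intro arg_cong2[where f = "(+)"] sum.cong refl) (simp_all only: low high lessThan_iff)
  finally show "estimator_variance (nthr S - 1) (ncell S) (del_kern S k) R =
      (\<Sum>m<k-1. v m / real (total_rep R m)) + (v (k - 1) + v k) / real (total_rep R (k - 1))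
      + (\<Sum>m=k+1..nthr S. v m / real (total_rep R (m - 1)))"
    unfolding L_def .
  show "mean_cost (nthr S - 1) (ncell S) (del_kern S k) R u =
      (\<Sum>n<k-1. real (total_rep R n) * gam_int S n (u n))
      + real (total_rep R (k - 1)) * gam_int S (k - 1) (u (k - 1))
      + (\<Sum>n=k+1..nthr S. real (total_rep R (n - 1)) * gam_int S n (u (n - 1)))"
    unfolding L_def[symmetric] sch.mean_cost_eq split
  proof (intro arg_cong2[where f = "(+)"] arg_cong2[where f = "(*)"] sum.cong refl)
    show "sch.gamma_val n (u n) = gam_int S n (u n)" if "n \<in> {..<k-1}" for n
      using that k by (auto simp: occ old_level_def)
    show "sch.gamma_val (k - 1) (u (k - 1)) = gam_int S (k - 1) (u (k - 1))"
      using k by (simp add: occ old_level_def)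
    show "sch.gamma_val (n - 1) (u (n - 1)) = gam_int S n (u (n - 1))" if n: "n \<in> {k+1..nthr S}" for n
    proof -
      have "old_level k (n - 1) = n" "n - 1 \<le> nthr S" using n by (auto simp: old_level_def)
      then show ?thesis by (simp add: occ)
    qed
  qed
qed

end

text \<open>
  At the merged step the factor \<open>R k\<close> is absorbed into the new replication number, so from there on
  the products telescope to those of the full algorithm, one level later, times the product of the \<open>lam q\<close>.
\<close>

lemma total_rep_del_rep:
  assumes k: "1 \<le> k" "k \<le> M"
    and R': "\<And>j. j \<le> M - 1 \<Longrightarrow> real (R' j) = del_rep lam R k j"
  shows "j < k - 1 \<Longrightarrow> total_rep R' j = total_rep R j"
    and "k - 1 \<le> j \<Longrightarrow> j \<le> M - 1 \<Longrightarrow>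
      real (total_rep R' j) = (\<Prod>q=k-1..j. lam q) * real (total_rep R (j + 1))"
proof -
  have low: "R' j = R j" if "j < k - 1" for j
    using R'[of j] that k by (simp add: del_rep_def)
  then show "j < k - 1 \<Longrightarrow> total_rep R' j = total_rep R j"
    unfolding total_rep_def by (intro prod.cong) auto
  have Suc: "total_rep Q (Suc n) = total_rep Q n * Q (Suc n)" for Q n
    by (simp add: total_rep_def)
  show "real (total_rep R' j) = (\<Prod>q=k-1..j. lam q) * real (total_rep R (j + 1))"
    if "k - 1 \<le> j" "j \<le> M - 1"
    using that
  proof (induction j rule: dec_induct)
    case base
    show ?case
    proof (cases "k - 1")
      case 0
      with k have "k = 1" by simp
      then show ?thesis using R'[of 0] k by (simp add: total_rep_def del_rep_def)
    next
      case (Suc n)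
      then have "total_rep R' n = total_rep R n"
        using low unfolding total_rep_def by (intro prod.cong) auto
      moreover have "real (R' (Suc n)) = lam (Suc n) * real (R (Suc n)) * real (R (Suc (Suc n)))"
      proof -
        have "k = Suc (Suc n)" using Suc by simp
        then show ?thesis using R'[of "Suc n"] k by (simp add: del_rep_def)
      qed
      ultimately show ?thesis using Suc by (simp add: \<open>\<And>Q n. total_rep Q (Suc n) = _\<close>)
    qed
  next
    case (step j)
    then have "real (R' (Suc j)) = lam (Suc j) * real (R (Suc (Suc j)))"
      using R'[of "Suc j"] k by (simp add: del_rep_def)
    with step show ?case by (simp add: Suc)
  qed
qed

theorem proposition5p1:
  fixes S :: "('w, 'x::topological_space) splitting"
    and M s N k :: nat
    and R R' :: "nat \<Rightarrow> nat"
    and lam Lam :: "nat \<Rightarrow> real"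
    and c :: "real \<Rightarrow> real"
    and ct :: "nat \<Rightarrow> real"
    and r :: "nat \<Rightarrow> real"
  assumes model: "splitting_model S"
    and M: "M = nthr S"
    and s: "s = ncell S"
    and nonzero: "\<And>j. 1 \<le> j \<Longrightarrow> j \<le> M + 1 \<Longrightarrow> gam_int S j (\<lambda>_. 1) \<noteq> 0"
    and N: "N \<ge> 1" "R 0 = N"
    and R: "\<And>j. 1 \<le> j \<Longrightarrow> j \<le> M \<Longrightarrow> R j \<ge> 1"
    and r: "\<And>n. r n = real (total_rep R n)"
    and c_pos: "\<And>x. 0 < x \<Longrightarrow> x \<le> 1 \<Longrightarrow> c x > 0"
    and c_decr: "antimono_on {0<..1} c"
    and k: "1 \<le> k" "k \<le> M"
    and lam_pos: "\<And>j. k - 1 \<le> j \<Longrightarrow> j \<le> M - 1 \<Longrightarrow> lam j > 0"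
    and R': "\<And>j. j \<le> M - 1 \<Longrightarrow> R' j \<ge> 1"
            "\<And>j. j \<le> M - 1 \<Longrightarrow> real (R' j) = del_rep lam R k j"
    and Lam: "\<And>q. k - 1 \<le> q \<Longrightarrow> q \<le> M - 1 \<Longrightarrow> Lam q = (\<Prod>j=k-1..q. lam j)"
    and const: "\<And>j. 1 \<le> j \<Longrightarrow> j \<le> M \<Longrightarrow> constant_on_level S j (target_prob S j)"
  shows "estimator_variance M s (kern S) R =
           estimator_variance (M - 1) s (del_kern S k) R'
           + 1 / r (k - 1) * (1 - 1 / (Lam (k - 1) * real (R k)))
               * gam_int S (k - 1) (Gamma_op S k (target_prob S k))
           + (\<Sum>j=k..M. 1 / r j * (1 - 1 / Lam (j - 1))
               * gam_int S j (Gamma_op S (j + 1) (target_prob S (j + 1))))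
       \<and> mean_cost M s (kern S) R (unit_cost c S) =
           mean_cost (M - 1) s (del_kern S k) R' (del_cost c ct S k)
           + r (k - 1) * (gam_int S (k - 1) (unit_cost c S (k - 1))
               - real (R k) * Lam (k - 1) * gam_int S (k - 1) ct)
           + r k * gam_int S k (unit_cost c S k)
           + (\<Sum>j=k+1..M. r j * gam_int S j (unit_cost c S j) * (1 - Lam (j - 1)))"
proof -
  interpret splitting_model S by (rule model)
  have R_pos: "\<forall>n\<le>nthr S. R n \<ge> 1"
  proof (intro allI impI)
    show "R n \<ge> 1" if "n \<le> nthr S" for n
      using that N R[of n] M by (cases n) auto
  qed
  have p: "gam S (nthr S + 1) 1 \<noteq> 0"
    using nonzero[of "M + 1"] by (simp add: M gam_int_def cells_def)
  have R'_pos: "\<forall>n\<le>nthr S - 1. R' n \<ge> 1"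
    using R'(1) M by simp
  have k': "1 \<le> k" "k \<le> nthr S" using k M by auto
  define v where "v m = gam_int S m (Gamma_op S (m + 1) (target_prob S (m + 1)))" for m
  have r_k: "r k = r (k - 1) * real (R k)"
    using k(1) unfolding r total_rep_def by (cases k) simp_all
  have r'_low: "real (total_rep R' j) = r j" if "j < k - 1" for j
    using total_rep_del_rep(1)[OF k R'(2) that] by (simp add: r)
  have r'_high: "real (total_rep R' j) = Lam j * r (j + 1)" if "k - 1 \<le> j" "j \<le> M - 1" for j
    using total_rep_del_rep(2)[OF k R'(2) that] Lam[OF that] by (simp add: r)
  have r'_mid: "real (total_rep R' (k - 1)) = Lam (k - 1) * r k"
    using r'_high[of "k - 1"] k by simp
  have r'_shift: "real (total_rep R' (m - 1)) = Lam (m - 1) * r m" if "m \<in> {k+1..M}" for m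
    using r'_high[of "m - 1"] that k by auto
  have first: "(\<Sum>j=k..M. f j) = f k + (\<Sum>j=k+1..M. f j)" for f :: "nat \<Rightarrow> real"
    using k by (simp add: sum.atLeast_Suc_atMost)

  have V: "estimator_variance M s (kern S) R =
      (\<Sum>m<k-1. v m / r m) + v (k - 1) / r (k - 1) + v k / r k + (\<Sum>m=k+1..M. v m / r m)"
    using variance_and_cost_kern(1)[of R, OF R_pos p]
    unfolding v_def[symmetric] r[symmetric] M[symmetric] s[symmetric] sum_thresholds_split[OF k] by simp
  have V': "estimator_variance (M - 1) s (del_kern S k) R' =
      (\<Sum>m<k-1. v m / r m) + (v (k - 1) + v k) / (Lam (k - 1) * r k)
      + (\<Sum>m=k+1..M. v m / (Lam (m - 1) * r m))"
    using variance_and_cost_del_kern(1)[of k R', OF k' R'_pos p]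
    unfolding v_def[symmetric] M[symmetric] s[symmetric] r'_mid
    by (elim trans, intro arg_cong2[where f = "(+)"] sum.cong refl) (simp_all only: r'_low r'_shift lessThan_iff)
  have tail: "(\<Sum>m=k+1..M. v m / r m) = (\<Sum>m=k+1..M. v m / (Lam (m - 1) * r m))
      + (\<Sum>m=k+1..M. 1 / r m * (1 - 1 / Lam (m - 1)) * v m)"
    unfolding sum.distrib[symmetric] by (intro sum.cong refl) (simp add: divide_inverse algebra_simps)
  have var: "estimator_variance M s (kern S) R = estimator_variance (M - 1) s (del_kern S k) R'
      + 1 / r (k - 1) * (1 - 1 / (Lam (k - 1) * real (R k))) * v (k - 1)
      + (\<Sum>j=k..M. 1 / r j * (1 - 1 / Lam (j - 1)) * v j)"
    unfolding V V' tail first r_k by (simp add: algebra_simps add_divide_distrib diff_divide_distrib)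

  define \<gamma> where "\<gamma> n = gam_int S n (unit_cost c S n)" for n
  have C: "mean_cost M s (kern S) R (unit_cost c S) =
      (\<Sum>n<k-1. r n * \<gamma> n) + r (k - 1) * \<gamma> (k - 1) + r k * \<gamma> k + (\<Sum>n=k+1..M. r n * \<gamma> n)"
    using variance_and_cost_kern(2)[of R, OF R_pos p, of "unit_cost c S"]
    unfolding \<gamma>_def[symmetric] r[symmetric] M[symmetric] s[symmetric] sum_thresholds_split[OF k] by simp
  have C': "mean_cost (M - 1) s (del_kern S k) R' (del_cost c ct S k) =
      (\<Sum>n<k-1. r n * \<gamma> n) + Lam (k - 1) * r k * gam_int S (k - 1) ct
      + (\<Sum>n=k+1..M. Lam (n - 1) * r n * \<gamma> n)"
  proof -
    have cost: "del_cost c ct S k n = unit_cost c S n" if "n < k - 1" for n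
      using that by (intro ext) (simp add: del_cost_def)
    have cost_mid: "del_cost c ct S k (k - 1) = ct"
      by (intro ext) (simp add: del_cost_def)
    have cost_high: "del_cost c ct S k (n - 1) = unit_cost c S n" if "n \<in> {k+1..M}" for n
      using that k by (intro ext) (auto simp: del_cost_def)
    show ?thesis
      using variance_and_cost_del_kern(2)[of k R', OF k' R'_pos p, of "del_cost c ct S k"]
      unfolding M[symmetric] s[symmetric] r'_mid cost_mid
      by (elim trans, intro arg_cong2[where f = "(+)"] sum.cong refl)
        (simp_all only: r'_low r'_shift cost cost_high \<gamma>_def lessThan_iff)
  qed
  have "(\<Sum>n=k+1..M. r n * \<gamma> n) =
      (\<Sum>n=k+1..M. Lam (n - 1) * r n * \<gamma> n) + (\<Sum>n=k+1..M. r n * \<gamma> n * (1 - Lam (n - 1)))"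
    unfolding sum.distrib[symmetric] by (intro sum.cong refl) (simp add: algebra_simps)
  then have "mean_cost M s (kern S) R (unit_cost c S) =
      mean_cost (M - 1) s (del_kern S k) R' (del_cost c ct S k)
      + r (k - 1) * (\<gamma> (k - 1) - real (R k) * Lam (k - 1) * gam_int S (k - 1) ct)
      + r k * \<gamma> k + (\<Sum>n=k+1..M. r n * \<gamma> n * (1 - Lam (n - 1)))"
    unfolding C C' r_k by (simp add: algebra_simps)
  moreover have "v (k - 1) = gam_int S (k - 1) (Gamma_op S k (target_prob S k))"
    using k by (simp add: v_def)
  ultimately show ?thesis
    using var unfolding v_def \<gamma>_def by simp
qed

end
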